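(* Let $1\le p<\infty$ and let $X$, $Y$ be Banach spaces. Suppose that $L_{w^*}(X^*,Y)$ has the Gelfand-Phillips (GP) property (resp. the $p$-Gelfand-Phillips ($p$-GP) property). Then $X$ and $Y$ have the GP property (resp. the $p$-GP property), and either $\ell_2\not\hookrightarrow X$ or $\ell_2\not\hookrightarrow Y$. If moreover $Y$ is a dual space $Z^*$ (for a Banach space $Z$), the condition $\ell_2\not\hookrightarrow Y$ implies $\ell_1\not\hookrightarrow Z$.
   Context: Operators are continuous linear maps, with the operator norm. $L_{w^*}(X^*,Y)$ is the space of $w^*$-$w$ continuous operators from $X^*$ to $Y$. $E\hookrightarrow F$ means that $E$ is isomorphic to a closed subspace of $F$. "Either ... or ..." is inclusive. A bounded subset $A$ of a Banach space $E$ is limited if every $w^*$-null sequence $(e_n^* )$ in $E^*$ satisfies $\sup_{x\in A}|e_n^*(x)|\to 0$. A sequence is limited if its set of terms is limited. A sequence $(x_n)$ in $E$ is weakly $p$-summable if $(x^*(x_n))_n\in\ell_p$ for every $x^*\in E^*$. $E$ has the Gelfand-Phillips (GP) property if every limited subset of $E$ is relatively compact. $E$ has the $p$-Gelfand-Phillips ($p$-GP) property if every limited weakly $p$-summable sequence in $E$ (i.e. both limited and weakly $p$-summable) is norm null.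
   Formalization: X and Y are assumed nonzero: if X = 0 and Y = ℓ_∞, then L_{w*}(X*,Y) = 0 has the GP and p-GP properties while Y has neither. Banach spaces are taken over the reals. *)

theory Defs
  imports "HOL-Analysis.Analysis"
begin

text \<open>The scalars are real: the dual of \<open>'a\<close> is the type \<open>'a \<Rightarrow>\<^sub>L real\<close>. The weak* topology is
  the topology of pointwise convergence on it, i.e. the strong operator topology.\<close>

definition weak_star_topology :: "('a::real_normed_vector \<Rightarrow>\<^sub>L real) topology" where
  "weak_star_topology = strong_operator_topology"

definition weak_topology :: "'a::real_normed_vector topology" where
  "weak_topology = pullback_topology UNIV (\<lambda>x (f :: 'a \<Rightarrow>\<^sub>L real). blinfun_apply f x) euclidean"

lemma topspace_weak_star_topology [simp]: "topspace weak_star_topology = UNIV"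
  by (simp add: weak_star_topology_def strong_operator_topology_topspace)

lemma topspace_weak_topology [simp]: "topspace weak_topology = UNIV"
  by (simp add: weak_topology_def topspace_pullback_topology)

lemma continuous_map_weak_topology_iff:
  fixes g :: "'b \<Rightarrow> 'a::real_normed_vector"
  shows "continuous_map T weak_topology g \<longleftrightarrow>
    (\<forall>f :: 'a \<Rightarrow>\<^sub>L real. continuous_map T euclideanreal (\<lambda>y. blinfun_apply f (g y)))"
    (is "?L \<longleftrightarrow> ?R")
proof
  assume L: ?L
  show ?R
  proof
    fix f :: "'a \<Rightarrow>\<^sub>L real"
    have "continuous_map weak_topology euclideanreal
        ((\<lambda>h. h f) \<circ> (\<lambda>x (f :: 'a \<Rightarrow>\<^sub>L real). blinfun_apply f x))"
      unfolding weak_topology_def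
      by (rule continuous_map_pullback) (use continuous_on_product_coordinates in fastforce)
    from continuous_map_compose[OF L this]
    show "continuous_map T euclideanreal (\<lambda>y. blinfun_apply f (g y))"
      by (simp add: comp_def)
  qed
next
  assume R: ?R
  have "continuous_map T euclidean ((\<lambda>x (f :: 'a \<Rightarrow>\<^sub>L real). blinfun_apply f x) \<circ> g)"
    using R by (simp add: o_def euclidean_product_topology[symmetric]
        continuous_map_componentwise_UNIV)
  then show ?L
    unfolding weak_topology_def by (intro continuous_map_pullback') auto
qed

text \<open>\<open>('a, 'b) wstar_op\<close> is the space of all bounded operators from the dual of \<open>'a\<close> to \<open>'b\<close>
  that are weak*-to-weak continuous, with the operator norm.\<close>

definition wstar_weak_continuous ::
    "(('a::real_normed_vector \<Rightarrow>\<^sub>L real) \<Rightarrow>\<^sub>L 'b::real_normed_vector) \<Rightarrow> bool" where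
  "wstar_weak_continuous T \<longleftrightarrow>
    continuous_map weak_star_topology weak_topology (blinfun_apply T)"

lemma wstar_weak_continuous_0: "wstar_weak_continuous 0"
  by (simp add: wstar_weak_continuous_def continuous_map_weak_topology_iff)

lemma wstar_weak_continuous_add:
  "wstar_weak_continuous S \<Longrightarrow> wstar_weak_continuous T \<Longrightarrow> wstar_weak_continuous (S + T)"
  by (simp add: wstar_weak_continuous_def continuous_map_weak_topology_iff
      blinfun.bilinear_simps continuous_map_add)

lemma wstar_weak_continuous_scaleR:
  "wstar_weak_continuous T \<Longrightarrow> wstar_weak_continuous (c *\<^sub>R T)"
  by (simp add: wstar_weak_continuous_def continuous_map_weak_topology_iff
      blinfun.bilinear_simps continuous_map_real_mult_left)

lemma wstar_weak_continuous_uminus: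
  "wstar_weak_continuous T \<Longrightarrow> wstar_weak_continuous (- T)"
  using wstar_weak_continuous_scaleR[of T "-1"] by simp

lemma wstar_weak_continuous_diff:
  "wstar_weak_continuous S \<Longrightarrow> wstar_weak_continuous T \<Longrightarrow> wstar_weak_continuous (S - T)"
  using wstar_weak_continuous_add[of S "- T"] wstar_weak_continuous_uminus[of T] by simp

typedef (overloaded) ('a, 'b) wstar_op =
    "{T :: ('a::real_normed_vector \<Rightarrow>\<^sub>L real) \<Rightarrow>\<^sub>L 'b::real_normed_vector.
       wstar_weak_continuous T}"
  morphisms op_of Wstar_op
  using wstar_weak_continuous_0 by blast

lemma wstar_weak_continuous_op_of: "wstar_weak_continuous (op_of T)"
  using op_of by blast

lemma op_of_Wstar_op: "wstar_weak_continuous T \<Longrightarrow> op_of (Wstar_op T) = T"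
  by (simp add: Wstar_op_inverse)

instantiation wstar_op :: (real_normed_vector, real_normed_vector) real_normed_vector
begin

definition zero_wstar_op :: "('a, 'b) wstar_op" where
  "0 = Wstar_op 0"

definition plus_wstar_op :: "('a, 'b) wstar_op \<Rightarrow> ('a, 'b) wstar_op \<Rightarrow> ('a, 'b) wstar_op" where
  "S + T = Wstar_op (op_of S + op_of T)"

definition minus_wstar_op :: "('a, 'b) wstar_op \<Rightarrow> ('a, 'b) wstar_op \<Rightarrow> ('a, 'b) wstar_op" where
  "S - T = Wstar_op (op_of S - op_of T)"

definition uminus_wstar_op :: "('a, 'b) wstar_op \<Rightarrow> ('a, 'b) wstar_op" where
  "- T = Wstar_op (- op_of T)"

definition scaleR_wstar_op :: "real \<Rightarrow> ('a, 'b) wstar_op \<Rightarrow> ('a, 'b) wstar_op" where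
  "c *\<^sub>R T = Wstar_op (c *\<^sub>R op_of T)"

definition norm_wstar_op :: "('a, 'b) wstar_op \<Rightarrow> real" where
  "norm T = norm (op_of T)"

definition dist_wstar_op :: "('a, 'b) wstar_op \<Rightarrow> ('a, 'b) wstar_op \<Rightarrow> real" where
  "dist_wstar_op S T = norm (S - T)"

definition sgn_wstar_op :: "('a, 'b) wstar_op \<Rightarrow> ('a, 'b) wstar_op" where
  "sgn_wstar_op T = inverse (norm T) *\<^sub>R T"

definition uniformity_wstar_op :: "(('a, 'b) wstar_op \<times> ('a, 'b) wstar_op) filter" where
  "uniformity_wstar_op = (INF e\<in>{0 <..}. principal {(S, T). dist S T < e})"

definition open_wstar_op :: "('a, 'b) wstar_op set \<Rightarrow> bool" where
  "open_wstar_op U = (\<forall>S\<in>U. \<forall>\<^sub>F (S', T) in uniformity. S' = S \<longrightarrow> T \<in> U)"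

lemma op_of_zero: "op_of 0 = 0"
  by (simp add: zero_wstar_op_def op_of_Wstar_op wstar_weak_continuous_0)

lemma op_of_add: "op_of (S + T) = op_of S + op_of T"
  by (simp add: plus_wstar_op_def op_of_Wstar_op wstar_weak_continuous_add
      wstar_weak_continuous_op_of)

lemma op_of_diff: "op_of (S - T) = op_of S - op_of T"
  by (simp add: minus_wstar_op_def op_of_Wstar_op wstar_weak_continuous_diff
      wstar_weak_continuous_op_of)

lemma op_of_uminus: "op_of (- T) = - op_of T"
  by (simp add: uminus_wstar_op_def op_of_Wstar_op wstar_weak_continuous_uminus
      wstar_weak_continuous_op_of)

lemma op_of_scaleR: "op_of (c *\<^sub>R T) = c *\<^sub>R op_of T"
  by (simp add: scaleR_wstar_op_def op_of_Wstar_op wstar_weak_continuous_scaleR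
      wstar_weak_continuous_op_of)

lemmas op_of_simps = op_of_zero op_of_add op_of_diff op_of_uminus op_of_scaleR

instance
proof
  fix S T U :: "('a, 'b) wstar_op" and a b :: real
  show "S + T + U = S + (T + U)" "S + T = T + S" "0 + S = S" "- S + S = 0" "S - T = S + - T"
    "a *\<^sub>R (S + T) = a *\<^sub>R S + a *\<^sub>R T" "(a + b) *\<^sub>R S = a *\<^sub>R S + b *\<^sub>R S"
    "a *\<^sub>R b *\<^sub>R S = (a * b) *\<^sub>R S" "1 *\<^sub>R S = S"
    by (simp_all add: op_of_inject[symmetric] op_of_simps scaleR_add_left scaleR_add_right)
  show "dist S T = norm (S - T)"
    by (fact dist_wstar_op_def)
  show "sgn S = inverse (norm S) *\<^sub>R S"
    by (fact sgn_wstar_op_def)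
  show "(uniformity :: (('a, 'b) wstar_op \<times> ('a, 'b) wstar_op) filter) =
      (INF e\<in>{0 <..}. principal {(S, T). dist S T < e})"
    by (fact uniformity_wstar_op_def)
  show "open V = (\<forall>S\<in>V. \<forall>\<^sub>F (S', T) in uniformity. S' = S \<longrightarrow> T \<in> V)"
    for V :: "('a, 'b) wstar_op set"
    by (fact open_wstar_op_def)
  show "norm S = 0 \<longleftrightarrow> S = 0"
    by (simp add: norm_wstar_op_def op_of_inject[symmetric] op_of_zero)
  show "norm (S + T) \<le> norm S + norm T"
    by (simp add: norm_wstar_op_def op_of_add norm_triangle_ineq)
  show "norm (a *\<^sub>R S) = \<bar>a\<bar> * norm S"
    by (simp add: norm_wstar_op_def op_of_scaleR)
qed

end

definition ell :: "real \<Rightarrow> (nat \<Rightarrow> real) set" where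
  "ell p = {a. summable (\<lambda>n. \<bar>a n\<bar> powr p)}"

definition ell_norm :: "real \<Rightarrow> (nat \<Rightarrow> real) \<Rightarrow> real" where
  "ell_norm p a = (\<Sum>n. \<bar>a n\<bar> powr p) powr (1 / p)"

text \<open>\<open>ell p\<close> is isomorphic to a closed subspace \<open>M\<close> of \<open>'a\<close>: there is a linear bijection \<open>T\<close> from
  \<open>ell p\<close> onto \<open>M\<close> such that \<open>T\<close> and its inverse are bounded.\<close>

definition ell_embeds :: "real \<Rightarrow> 'a::real_normed_vector itself \<Rightarrow> bool" where
  "ell_embeds p (_ :: 'a itself) \<longleftrightarrow>
    (\<exists>(M :: 'a set) T c C. subspace M \<and> closed M \<and> bij_betw T (ell p) M \<and>
      (\<forall>a\<in>ell p. \<forall>b\<in>ell p. T (\<lambda>n. a n + b n) = T a + T b) \<and>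
      (\<forall>a\<in>ell p. \<forall>r. T (\<lambda>n. r * a n) = r *\<^sub>R T a) \<and>
      0 < c \<and> 0 < C \<and>
      (\<forall>a\<in>ell p. c * ell_norm p a \<le> norm (T a) \<and> norm (T a) \<le> C * ell_norm p a))"

text \<open>The supremum is taken in \<open>ennreal\<close>, so that it is \<open>0\<close> for the empty set.\<close>

definition limited :: "'a::real_normed_vector set \<Rightarrow> bool" where
  "limited A \<longleftrightarrow> bounded A \<and>
    (\<forall>f :: nat \<Rightarrow> 'a \<Rightarrow>\<^sub>L real. limitin weak_star_topology f 0 sequentially \<longrightarrow>
      (\<lambda>n. SUP x\<in>A. ennreal \<bar>blinfun_apply (f n) x\<bar>) \<longlonglongrightarrow> 0)"

definition weakly_summable :: "real \<Rightarrow> (nat \<Rightarrow> 'a::real_normed_vector) \<Rightarrow> bool" where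
  "weakly_summable p x \<longleftrightarrow> (\<forall>f :: 'a \<Rightarrow>\<^sub>L real. (\<lambda>n. blinfun_apply f (x n)) \<in> ell p)"

definition gelfand_phillips :: "'a::real_normed_vector itself \<Rightarrow> bool" where
  "gelfand_phillips (_ :: 'a itself) \<longleftrightarrow> (\<forall>A :: 'a set. limited A \<longrightarrow> compact (closure A))"

definition p_gelfand_phillips :: "real \<Rightarrow> 'a::real_normed_vector itself \<Rightarrow> bool" where
  "p_gelfand_phillips p (_ :: 'a itself) \<longleftrightarrow>
    (\<forall>x :: nat \<Rightarrow> 'a. limited (range x) \<and> weakly_summable p x \<longrightarrow> x \<longlonglongrightarrow> 0)"

text \<open>\<open>'y\<close> is (isometrically isomorphic to) the dual of \<open>'z\<close>.\<close>

definition is_dual_of :: "'y::real_normed_vector itself \<Rightarrow> 'z::real_normed_vector itself \<Rightarrow> bool" where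
  "is_dual_of (_ :: 'y itself) (_ :: 'z itself) \<longleftrightarrow>
    (\<exists>J :: 'y \<Rightarrow> ('z \<Rightarrow>\<^sub>L real). linear J \<and> bij J \<and> (\<forall>y. norm (J y) = norm y))"

lemma is_dual_of_dual: "is_dual_of TYPE('z::real_normed_vector \<Rightarrow>\<^sub>L real) TYPE('z)"
  unfolding is_dual_of_def by (intro exI[of _ "\<lambda>f. f"]) (auto simp: linear_iff bij_def surj_def inj_def)

end

theory Submission
  imports Defs
begin

text \<open>The maps \<open>x \<mapsto> x \<otimes> y\<^sub>0\<close> and \<open>y \<mapsto> x\<^sub>0 \<otimes> y\<close> (with unit vectors \<open>x\<^sub>0\<close>, \<open>y\<^sub>0\<close>) are isometric embeddings
  into the operator space, and both properties pass to closed subspaces.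

  If \<open>x\<^sub>k\<close> and \<open>y\<^sub>k\<close> span copies of \<open>\<ell>\<^sub>2\<close>, then \<open>A \<mapsto> T\<^sub>A = \<Sum>k\<in>A. x\<^sub>k \<otimes> y\<^sub>k\<close> is bounded and finitely
  additive on all sets \<open>A\<close> of naturals (the diagonal operators form a copy of \<open>\<ell>\<^sub>\<infinity>\<close>). By a weak form
  of Phillips' lemma, functionals that tend to \<open>0\<close> at every \<open>T\<^sub>A\<close> tend to \<open>0\<close> uniformly on the atoms
  \<open>x\<^sub>k \<otimes> y\<^sub>k\<close>, which are therefore a limited sequence; it is weakly \<open>1\<close>-summable and bounded away from
  \<open>0\<close>. So the \<open>p\<close>-GP property fails, and a fortiori the GP property.

  Finally, if \<open>\<ell>\<^sub>1\<close> embeds in \<open>Z\<close>, let the unit vectors of \<open>\<ell>\<^sub>1\<close> run through all sign-valued functions of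
  finitely many Rademacher variables, and let \<open>f\<^sub>k\<close> be an extension to \<open>Z\<close> of \<open>g \<mapsto> E(r\<^sub>k g)\<close>. Then
  \<open>\<parallel>\<Sum>a\<^sub>k f\<^sub>k\<parallel>\<close> is equivalent to \<open>E\<bar>\<Sum>a\<^sub>k r\<^sub>k\<bar>\<close>, which is equivalent to the \<open>\<ell>\<^sub>2\<close> norm by Khintchine's
  inequality.\<close>

section \<open>The Hahn--Banach theorem\<close>

text \<open>Zorn's lemma is applied to graphs of partial functionals, taken as subspaces of
  \<open>'a \<times> real\<close>. Single-valuedness need not be part of \<G>: if a subspace below
  \<open>p\<close> contains \<open>(x, r)\<close> and \<open>(x, s)\<close>, it contains
  \<open>(0, r - s)\<close> and \<open>(0, s - r)\<close>, and \<open>p 0 = 0\<close> forces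
  \<open>r = s\<close>.\<close>

lemma hahn_banach_sublinear:
  fixes p :: "'a::real_vector \<Rightarrow> real"
  assumes subadd: "\<And>x y. p (x + y) \<le> p x + p y"
    and homog: "\<And>c x. 0 \<le> c \<Longrightarrow> p (c *\<^sub>R x) = c * p x"
    and M: "subspace M"
    and add: "\<And>x y. x \<in> M \<Longrightarrow> y \<in> M \<Longrightarrow> \<phi> (x + y) = \<phi> x + \<phi> y"
    and scale: "\<And>c x. x \<in> M \<Longrightarrow> \<phi> (c *\<^sub>R x) = c * \<phi> x"
    and le: "\<And>x. x \<in> M \<Longrightarrow> \<phi> x \<le> p x"
  obtains g where "linear g" "\<And>x. x \<in> M \<Longrightarrow> g x = \<phi> x" "\<And>x. g x \<le> p x"
proof -
  define \<G> where "\<G> = {G :: ('a \<times> real) set. subspace G \<and> (\<forall>x\<in>M. (x, \<phi> x) \<in> G) \<and> (\<forall>(x, r)\<in>G. r \<le> p x)}"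
  have p0: "p 0 = 0"
    using homog[of 0 0] by simp
  have "(\<lambda>x. (x, \<phi> x)) ` M \<in> \<G>"
  proof -
    have "\<phi> 0 = 0"
      using scale[of 0 0] subspace_0[OF M] by simp
    then have "subspace ((\<lambda>x. (x, \<phi> x)) ` M)"
      unfolding subspace_def using M
      by (auto simp: zero_prod_def image_iff add scale subspace_0 subspace_add subspace_scale)
    then show ?thesis
      using le by (auto simp: \<G>_def)
  qed
  then have ne: "\<G> \<noteq> {}" by blast
  have ch: "\<Union>\<C> \<in> \<G>" if "\<C> \<noteq> {}" and "subset.chain \<G> \<C>" for \<C>
  proof -
    have sub: "\<And>G. G \<in> \<C> \<Longrightarrow> subspace G" and \<C>: "\<C> \<subseteq> \<G>"
      and tot: "\<And>G H. G \<in> \<C> \<Longrightarrow> H \<in> \<C> \<Longrightarrow> G \<subseteq> H \<or> H \<subseteq> G"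
      using that by (auto simp: subset_chain_def \<G>_def)
    have "subspace (\<Union>\<C>)"
      unfolding subspace_def
    proof (intro conjI ballI allI)
      show "0 \<in> \<Union>\<C>"
        using that(1) sub subspace_0 by blast
      show "x + y \<in> \<Union>\<C>" if xy: "x \<in> \<Union>\<C>" "y \<in> \<Union>\<C>" for x y
      proof -
        obtain G H where "G \<in> \<C>" "x \<in> G" "H \<in> \<C>" "y \<in> H"
          using xy by blast
        then obtain K where "K \<in> \<C>" "x \<in> K" "y \<in> K"
          using tot[of G H] by blast
        then show ?thesis
          using subspace_add[OF sub] by blast
      qed
      show "c *\<^sub>R x \<in> \<Union>\<C>" if "x \<in> \<Union>\<C>" for c x
        using that sub subspace_scale by blast
    qed
    then show ?thesis
      using \<C> that(1) unfolding \<G>_def by fastforce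
  qed
  obtain G where "G \<in> \<G>" and max: "\<And>H. H \<in> \<G> \<Longrightarrow> G \<subseteq> H \<Longrightarrow> H = G"
    using subset_Zorn_nonempty[OF ne ch] by blast
  then have G: "subspace G" and GM: "\<And>x. x \<in> M \<Longrightarrow> (x, \<phi> x) \<in> G"
    and Gp: "\<And>x r. (x, r) \<in> G \<Longrightarrow> r \<le> p x"
    by (auto simp: \<G>_def)
  have uniq: "r = s" if "(x, r) \<in> G" "(x, s) \<in> G" for x r s
    using Gp[of 0 "r - s"] Gp[of 0 "s - r"] subspace_diff[OF G that] subspace_diff[OF G that(2,1)] p0
    by simp
  have total: "\<exists>r. (x0, r) \<in> G" for x0
  proof -
    define L where "L = (\<lambda>(x, r). r - p (x - x0)) ` G"
    \<comment> \<open>The value at \<open>x0\<close> has to lie above every left-hand side and below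
      every right-hand side; \<open>sep\<close> makes this possible, and the supremum
      \<open>c\<close> of the left-hand sides is one such value.\<close>
    have sep: "r - p (x - x0) \<le> p (x' + x0) - r'" if "(x, r) \<in> G" "(x', r') \<in> G" for x r x' r'
    proof -
      have "r + r' \<le> p (x + x')"
        using Gp subspace_add[OF G that] by simp
      also have "\<dots> \<le> p (x - x0) + p (x' + x0)"
        using subadd[of "x - x0" "x' + x0"] by (simp add: algebra_simps)
      finally show ?thesis by simp
    qed
    have G0: "(0, 0) \<in> G"
      using subspace_0[OF G] by (simp add: zero_prod_def)
    have Lne: "L \<noteq> {}" and Lbdd: "bdd_above L"
      using sep[OF _ G0] G0 by (auto simp: L_def intro!: bdd_aboveI)
    define c where "c = Sup L"
    have c1: "r - p (x - x0) \<le> c" if "(x, r) \<in> G" for x r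
      unfolding c_def by (rule cSup_upper[OF _ Lbdd]) (use that in \<open>force simp: L_def\<close>)
    have c2: "c \<le> p (x + x0) - r" if "(x, r) \<in> G" for x r
      unfolding c_def by (rule cSup_least[OF Lne]) (use that sep in \<open>auto simp: L_def\<close>)
    \<comment> \<open>After removing the multiple \<open>k\<close> of the new vector, division by
      \<bar>k\<bar> reduces \<open>k > 0\<close> to the upper bound \<open>c2\<close> and
      \<open>k < 0\<close> to the lower bound \<open>c1\<close>.\<close>
    have "r \<le> p x" if *: "(x, r) \<in> span (insert (x0, c) G)" for x r
    proof -
      obtain k where "(x, r) - k *\<^sub>R (x0, c) \<in> span G"
        using * unfolding span_breakdown_eq by blast
      then have k: "(x - k *\<^sub>R x0, r - k * c) \<in> G"
        using G by (simp add: span_eq_iff[THEN iffD2])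
      consider "k = 0" | "k > 0" | "k < 0" by linarith
      then show ?thesis
      proof cases
        case 1
        then show ?thesis using k Gp by simp
      next
        case 2
        have "(inverse k *\<^sub>R (x - k *\<^sub>R x0), inverse k * (r - k * c)) \<in> G"
          using subspace_scale[OF G k, of "inverse k"] by simp
        from c2[OF this] have "c \<le> p (inverse k *\<^sub>R x) - inverse k * (r - k * c)"
          using 2 by (simp add: scaleR_right_diff_distrib)
        also have "\<dots> = (p x - r) / k + c"
          using 2 by (simp add: homog field_simps)
        finally show ?thesis using 2 by (simp add: field_simps)
      next
        case 3
        have "(inverse (-k) *\<^sub>R (x - k *\<^sub>R x0), inverse (-k) * (r - k * c)) \<in> G"
          using subspace_scale[OF G k, of "inverse (-k)"] by simp
        from c1[OF this] have "inverse (-k) * (r - k * c) - p (inverse (-k) *\<^sub>R x) \<le> c"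
          using 3 by (simp add: scaleR_right_diff_distrib)
        moreover have "inverse (-k) * (r - k * c) - p (inverse (-k) *\<^sub>R x) = (r - p x) / (-k) + c"
          using 3 homog[of "inverse (-k)" x] by (simp add: field_simps)
        ultimately have "(r - p x) / (-k) \<le> 0" by linarith
        then show ?thesis using 3 by (simp add: field_simps)
      qed
    qed
    then have "span (insert (x0, c) G) \<in> \<G>"
      using GM by (auto simp: \<G>_def intro: span_base)
    then have "span (insert (x0, c) G) = G"
      by (rule max) (auto intro: span_base)
    then show ?thesis
      using span_base[of "(x0, c)" "insert (x0, c) G"] by auto
  qed
  define g where "g x = (THE r. (x, r) \<in> G)" for x
  have gG: "(x, g x) \<in> G" for x
    unfolding g_def using total[of x] uniq by (metis theI)
  have "linear g"
  proof
    show "g (x + y) = g x + g y" for x y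
      using subspace_add[OF G gG[of x] gG[of y]] gG[of "x + y"] uniq by simp
    show "g (c *\<^sub>R x) = c *\<^sub>R g x" for c x
      using subspace_scale[OF G gG[of x], of c] gG[of "c *\<^sub>R x"] uniq by simp
  qed
  then show thesis
    using that[of g] gG GM Gp uniq by blast
qed

lemma hahn_banach_norm:
  fixes M :: "'a::real_normed_vector set"
  assumes M: "subspace M"
    and add: "\<And>x y. x \<in> M \<Longrightarrow> y \<in> M \<Longrightarrow> \<phi> (x + y) = \<phi> x + \<phi> y"
    and scale: "\<And>c x. x \<in> M \<Longrightarrow> \<phi> (c *\<^sub>R x) = c * \<phi> x"
    and le: "\<And>x. x \<in> M \<Longrightarrow> \<bar>\<phi> x\<bar> \<le> C * norm x"
    and C: "0 \<le> C"
  obtains g :: "'a \<Rightarrow>\<^sub>L real" where "\<And>x. x \<in> M \<Longrightarrow> g x = \<phi> x" "norm g \<le> C"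
proof -
  obtain h where h: "linear h" "\<And>x. x \<in> M \<Longrightarrow> h x = \<phi> x" "\<And>x. h x \<le> C * norm x"
  proof (rule hahn_banach_sublinear[of "\<lambda>x. C * norm x" M \<phi>])
    show "C * norm (x + y) \<le> C * norm x + C * norm y" for x y :: 'a
      using mult_left_mono[OF norm_triangle_ineq C] by (simp add: distrib_left)
  qed (use assms in \<open>auto simp: abs_le_iff\<close>)
  have "\<bar>h x\<bar> \<le> C * norm x" for x
    using h(3)[of x] h(3)[of "- x"] linear_neg[OF h(1), of x] by simp
  then have bl: "bounded_linear h"
    using h(1) by (intro bounded_linear_intro[of _ C])
      (auto simp: linear_add linear_scale mult.commute)
  show thesis
  proof
    show "blinfun_apply (Blinfun h) x = \<phi> x" if "x \<in> M" for x
      using h(2) that bl by (simp add: bounded_linear_Blinfun_apply)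
    show "norm (Blinfun h) \<le> C"
      using \<open>\<And>x. \<bar>h x\<bar> \<le> C * norm x\<close> bl C
      by (intro norm_blinfun_bound) (auto simp: bounded_linear_Blinfun_apply)
  qed
qed

lemma norming_functional:
  fixes x :: "'a::real_normed_vector"
  obtains f :: "'a \<Rightarrow>\<^sub>L real" where "f x = norm x" "norm f \<le> 1"
proof (cases "x = 0")
  case True
  then show ?thesis using that[of 0] by simp
next
  case False
  define \<phi> where "\<phi> v = norm x * (THE k. v = k *\<^sub>R x)" for v
  have \<phi>: "\<phi> (k *\<^sub>R x) = k * norm x" for k
    using False by (simp add: \<phi>_def)
  obtain f :: "'a \<Rightarrow>\<^sub>L real" where "\<And>v. v \<in> span {x} \<Longrightarrow> f v = \<phi> v" "norm f \<le> 1"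
  proof (rule hahn_banach_norm[of "span {x}" \<phi> 1])
    show "\<phi> (u + v) = \<phi> u + \<phi> v" if "u \<in> span {x}" "v \<in> span {x}" for u v
      using that by (auto simp: span_singleton \<phi> ring_distribs simp flip: scaleR_left_distrib)
  qed (use subspace_span[of "{x}"] in \<open>auto simp: span_singleton \<phi> abs_mult\<close>)
  then show ?thesis
    using that[of f] \<phi>[of 1] span_base[of x "{x}"] by simp
qed

section \<open>Limited sets and the Gelfand--Phillips properties\<close>

lemma limitin_weak_star_iff:
  "limitin weak_star_topology f l F \<longleftrightarrow> (\<forall>x. ((\<lambda>n. blinfun_apply (f n) x) \<longlongrightarrow> blinfun_apply l x) F)"
proof
  assume L: "limitin weak_star_topology f l F"
  show "\<forall>x. ((\<lambda>n. blinfun_apply (f n) x) \<longlongrightarrow> blinfun_apply l x) F"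
    using continuous_map_limit[OF strong_operator_topology_continuous_evaluation
        L[unfolded weak_star_topology_def]] by (simp add: o_def)
next
  assume "\<forall>x. ((\<lambda>n. blinfun_apply (f n) x) \<longlongrightarrow> blinfun_apply l x) F"
  then have *: "limitin euclidean (\<lambda>n. blinfun_apply (f n)) (blinfun_apply l) F"
    unfolding euclidean_product_topology[symmetric] limitin_componentwise by simp
  show "limitin weak_star_topology f l F"
    unfolding limitin_def
  proof (intro conjI allI impI)
    fix U assume U: "openin weak_star_topology U \<and> l \<in> U"
    then obtain V where V: "open V" "U = blinfun_apply -` V"
      by (auto simp: weak_star_topology_def strong_operator_topology_def openin_pullback_topology)
    have "eventually (\<lambda>n. blinfun_apply (f n) \<in> V) F"
      using limitinD[OF *] U V by auto
    then show "eventually (\<lambda>n. f n \<in> U) F"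
      using V by simp
  qed simp
qed

text \<open>Trades the supremum in \<open>ennreal\<close> for uniform smallness on \<open>A\<close>,
  the form in which limitedness is used from here on.\<close>

lemma limited_iff:
  fixes A :: "'a::real_normed_vector set"
  shows "limited A \<longleftrightarrow> bounded A \<and>
    (\<forall>f :: nat \<Rightarrow> 'a \<Rightarrow>\<^sub>L real. (\<forall>x. (\<lambda>n. f n x) \<longlonglongrightarrow> 0) \<longrightarrow>
      (\<forall>e>0. eventually (\<lambda>n. \<forall>x\<in>A. \<bar>f n x\<bar> \<le> e) sequentially))"
proof -
  have "(\<lambda>n. SUP x\<in>A. ennreal \<bar>f n x\<bar>) \<longlonglongrightarrow> 0 \<longleftrightarrow>
      (\<forall>e>0. eventually (\<lambda>n. \<forall>x\<in>A. \<bar>f n x\<bar> \<le> e) sequentially)"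
    for f :: "nat \<Rightarrow> 'a \<Rightarrow>\<^sub>L real"
  proof
    assume L: "(\<lambda>n. SUP x\<in>A. ennreal \<bar>f n x\<bar>) \<longlonglongrightarrow> 0"
    show "\<forall>e>0. eventually (\<lambda>n. \<forall>x\<in>A. \<bar>f n x\<bar> \<le> e) sequentially"
    proof (intro allI impI)
      fix e :: real assume e: "e > 0"
      have "eventually (\<lambda>n. (SUP x\<in>A. ennreal \<bar>f n x\<bar>) < ennreal e) sequentially"
        using order_tendstoD(2)[OF L] e by simp
      then show "eventually (\<lambda>n. \<forall>x\<in>A. \<bar>f n x\<bar> \<le> e) sequentially"
      proof (rule eventually_mono, intro ballI)
        fix n x assume "(SUP x\<in>A. ennreal \<bar>f n x\<bar>) < ennreal e" "x \<in> A"
        then have "ennreal \<bar>f n x\<bar> < ennreal e"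
          by (meson SUP_upper le_less_trans)
        then show "\<bar>f n x\<bar> \<le> e"
          using e by (simp add: ennreal_less_iff)
      qed
    qed
  next
    assume R: "\<forall>e>0. eventually (\<lambda>n. \<forall>x\<in>A. \<bar>f n x\<bar> \<le> e) sequentially"
    show "(\<lambda>n. SUP x\<in>A. ennreal \<bar>f n x\<bar>) \<longlonglongrightarrow> 0"
    proof (rule order_tendstoI)
      fix a :: ennreal assume "0 < a"
      \<comment> \<open>Pointwise bounds give only a non-strict bound on the supremum, hence the
        intermediate \<open>b\<close>; being below \<open>a\<close>, it is finite even if
        \<open>a\<close> is infinite.\<close>
      then obtain b where b: "0 < b" "b < a"
        using dense by blast
      then have fin: "b \<noteq> top" by auto
      have "0 < enn2real b"
        using b fin by (simp add: enn2real_positive_iff top.not_eq_extremum)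
      with R have "eventually (\<lambda>n. \<forall>x\<in>A. \<bar>f n x\<bar> \<le> enn2real b) sequentially"
        by blast
      then show "eventually (\<lambda>n. (SUP x\<in>A. ennreal \<bar>f n x\<bar>) < a) sequentially"
      proof (rule eventually_mono)
        fix n assume n: "\<forall>x\<in>A. \<bar>f n x\<bar> \<le> enn2real b"
        have "ennreal \<bar>f n x\<bar> \<le> b" if "x \<in> A" for x
          using n that fin ennreal_leI[of "\<bar>f n x\<bar>" "enn2real b"]
          by (simp add: ennreal_enn2real top.not_eq_extremum)
        then have "(SUP x\<in>A. ennreal \<bar>f n x\<bar>) \<le> b"
          by (rule SUP_least)
        then show "(SUP x\<in>A. ennreal \<bar>f n x\<bar>) < a"
          using b by simp
      qed
    qed simp
  qed
  then show ?thesis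
    by (simp add: limited_def limitin_weak_star_iff)
qed

text \<open>The adjoint of \<open>T\<close> maps weak*-null sequences to weak*-null
  sequences.\<close>

lemma limited_image:
  assumes T: "bounded_linear T" and A: "limited A"
  shows "limited (T ` A)"
  unfolding limited_iff
proof (intro conjI allI impI)
  show "bounded (T ` A)"
    using A T bounded_linear_image by (auto simp: limited_def)
  fix f :: "nat \<Rightarrow> 'b \<Rightarrow>\<^sub>L real" and e :: real
  assume f: "\<forall>x. (\<lambda>n. f n x) \<longlonglongrightarrow> 0" and e: "e > 0"
  define h where "h n = f n o\<^sub>L Blinfun T" for n
  have h: "h n x = f n (T x)" for n x
    using T by (simp add: h_def bounded_linear_Blinfun_apply)
  then have "\<forall>x. (\<lambda>n. h n x) \<longlonglongrightarrow> 0"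
    using f by simp
  then have "eventually (\<lambda>n. \<forall>x\<in>A. \<bar>h n x\<bar> \<le> e) sequentially"
    using A e unfolding limited_iff by blast
  then show "eventually (\<lambda>n. \<forall>x\<in>T ` A. \<bar>f n x\<bar> \<le> e) sequentially"
    by (simp add: h)
qed

lemma weakly_summable_image:
  assumes T: "bounded_linear T" and x: "weakly_summable p x"
  shows "weakly_summable p (\<lambda>n. T (x n))"
  unfolding weakly_summable_def
proof
  fix f :: "'b \<Rightarrow>\<^sub>L real"
  have "(\<lambda>n. (f o\<^sub>L Blinfun T) (x n)) \<in> ell p"
    using x unfolding weakly_summable_def by blast
  then show "(\<lambda>n. f (T (x n))) \<in> ell p"
    using T by (simp add: bounded_linear_Blinfun_apply)
qed

text \<open>Completeness of \<open>'a\<close> makes \<open>range T\<close> closed, so the compact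
  closure of the image of \<open>A\<close> stays inside the range and can be pulled back by the
  isometric inverse.\<close>

lemma gelfand_phillips_isometry:
  fixes T :: "'a::banach \<Rightarrow> 'b::real_normed_vector"
  assumes T: "bounded_linear T" and iso: "\<And>x. norm (T x) = norm x"
    and GP: "gelfand_phillips TYPE('b)"
  shows "gelfand_phillips TYPE('a)"
  unfolding gelfand_phillips_def
proof (intro allI impI)
  fix A :: "'a set" assume "limited A"
  then have comp: "compact (closure (T ` A))"
    using limited_image[OF T] GP by (simp add: gelfand_phillips_def)
  interpret bounded_linear T by fact
  have dist_T: "dist (T x) (T y) = dist x y" for x y
    by (simp add: dist_norm iso flip: diff)
  have "complete (range T)"
    using complete_isometric_image[of 1 UNIV T] T iso complete_UNIV by simp
  then have "closed (range T)"
    by (rule complete_imp_closed)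
  then have sub: "closure (T ` A) \<subseteq> range T"
    by (simp add: closure_minimal image_mono)
  have inj: "inj T"
    using dist_T by (metis dist_eq_0_iff injI)
  have "continuous_on (closure (T ` A)) (inv T)"
    unfolding continuous_on_iff
  proof (intro ballI allI impI)
    fix x e assume "x \<in> closure (T ` A)" "(e::real) > 0"
    then show "\<exists>d>0. \<forall>x'\<in>closure (T ` A). dist x' x < d \<longrightarrow> dist (inv T x') (inv T x) < e"
      using sub by (intro exI[of _ e]) (auto simp: f_inv_into_f subset_iff simp flip: dist_T)
  qed
  then have *: "compact (inv T ` closure (T ` A))"
    using comp compact_continuous_image by blast
  have "A \<subseteq> inv T ` closure (T ` A)"
    using inj closure_subset[of "T ` A"] by (force simp: image_iff)
  then have "closure A \<subseteq> inv T ` closure (T ` A)"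
    using * by (simp add: closure_minimal compact_imp_closed)
  then show "compact (closure A)"
    using * by (metis closed_closure compact_Int_closed inf.absorb_iff2)
qed

lemma p_gelfand_phillips_isometry:
  fixes T :: "'a::real_normed_vector \<Rightarrow> 'b::real_normed_vector"
  assumes T: "bounded_linear T" and iso: "\<And>x. norm (T x) = norm x"
    and GP: "p_gelfand_phillips p TYPE('b)"
  shows "p_gelfand_phillips p TYPE('a)"
  unfolding p_gelfand_phillips_def
proof (intro allI impI, elim conjE)
  fix x :: "nat \<Rightarrow> 'a" assume x: "limited (range x)" "weakly_summable p x"
  have "limited (range (\<lambda>n. T (x n)))"
    using limited_image[OF T x(1)] by (simp add: image_image)
  then have "(\<lambda>n. T (x n)) \<longlonglongrightarrow> 0"
    using GP weakly_summable_image[OF T x(2)] unfolding p_gelfand_phillips_def by blast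
  then show "x \<longlonglongrightarrow> 0"
    by (simp add: iso tendsto_norm_zero_iff[symmetric, where f = x]
        tendsto_norm_zero_iff[symmetric, where f = "\<lambda>n. T (x n)"])
qed

section \<open>From the GP property to the \<open>p\<close>-GP property\<close>

lemma weakly_summable_imp_weakly_null:
  fixes x :: "nat \<Rightarrow> 'a::real_normed_vector" and f :: "'a \<Rightarrow>\<^sub>L real"
  assumes "weakly_summable p x" "0 < p"
  shows "(\<lambda>n. f (x n)) \<longlonglongrightarrow> 0"
proof -
  have "summable (\<lambda>n. \<bar>f (x n)\<bar> powr p)"
    using assms by (simp add: weakly_summable_def ell_def)
  then have "(\<lambda>n. \<bar>f (x n)\<bar> powr p) \<longlonglongrightarrow> 0"
    by (rule summable_LIMSEQ_zero)
  then have "(\<lambda>n. (\<bar>f (x n)\<bar> powr p) powr (1 / p)) \<longlonglongrightarrow> 0"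
    using tendsto_zero_powrI[of _ sequentially "\<lambda>_. 1 / p" "1 / p"] assms by simp
  then have "(\<lambda>n. \<bar>f (x n)\<bar>) \<longlonglongrightarrow> 0"
    using assms by (simp add: powr_powr)
  then show ?thesis
    by (simp add: tendsto_rabs_zero_iff)
qed

text \<open>If the sequence were not norm null, a subsequence bounded away from 0 would, by
  compactness, have a norm limit along a further subsequence; weak nullity makes that limit 0, a
  contradiction.\<close>

lemma gelfand_phillips_imp_p_gelfand_phillips:
  assumes GP: "gelfand_phillips TYPE('a::real_normed_vector)" and p: "0 < p"
  shows "p_gelfand_phillips p TYPE('a)"
  unfolding p_gelfand_phillips_def
proof (intro allI impI, elim conjE)
  fix x :: "nat \<Rightarrow> 'a" assume lim: "limited (range x)" and ws: "weakly_summable p x"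
  then have comp: "compact (closure (range x))"
    using GP by (simp add: gelfand_phillips_def)
  show "x \<longlonglongrightarrow> 0"
  proof (rule ccontr)
    assume "\<not> x \<longlonglongrightarrow> 0"
    then obtain e where e: "e > 0" "\<not> eventually (\<lambda>n. dist (x n) 0 < e) sequentially"
      unfolding tendsto_iff by blast
    then obtain r :: "nat \<Rightarrow> nat" where r: "strict_mono r" and xr: "\<And>n. e \<le> norm (x (r n))"
      using not_eventually_sequentiallyD[OF e(2)] by (auto simp: not_less)
    have "\<forall>n. (x \<circ> r) n \<in> closure (range x)"
      using closure_subset[of "range x"] by auto
    then obtain l s where s: "strict_mono s" and l: "(x \<circ> r \<circ> s) \<longlonglongrightarrow> l"
      using comp unfolding compact_def by blast
    \<comment> \<open>One functional norming \<open>l\<close> suffices to show that the norm limit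
      of a weakly null sequence vanishes.\<close>
    obtain f :: "'a \<Rightarrow>\<^sub>L real" where f: "f l = norm l"
      by (rule norming_functional)
    have "(\<lambda>n. f (x (r (s n)))) \<longlonglongrightarrow> f l"
      using l by (intro tendsto_intros) (simp add: o_def)
    moreover have "(\<lambda>n. f (x (r (s n)))) \<longlonglongrightarrow> 0"
      using LIMSEQ_subseq_LIMSEQ[OF weakly_summable_imp_weakly_null[OF ws p] strict_mono_o[OF r s]]
      by (simp add: o_def)
    ultimately have "norm l = 0"
      using f LIMSEQ_unique by fastforce
    moreover have "e \<le> norm l"
      using tendsto_norm[OF l] by (rule LIMSEQ_le_const) (auto simp: xr)
    ultimately show False
      using e(1) by simp
  qed
qed

section \<open>Weak*-to-weak continuous operators of rank one\<close>

text \<open>The hypothesis says that the adjoint of \<open>T\<close> takes its values in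
  \<open>'a\<close>, seen inside its bidual: each \<open>g\<close> composed with \<open>T\<close> is
  evaluation at a point, and evaluations are weak* continuous.\<close>

lemma wstar_weak_continuousI:
  fixes T :: "('a::real_normed_vector \<Rightarrow>\<^sub>L real) \<Rightarrow>\<^sub>L 'b::real_normed_vector"
  assumes "\<And>g :: 'b \<Rightarrow>\<^sub>L real. \<exists>v. \<forall>f. blinfun_apply g (T f) = blinfun_apply f v"
  shows "wstar_weak_continuous T"
  unfolding wstar_weak_continuous_def continuous_map_weak_topology_iff
proof
  fix g :: "'b \<Rightarrow>\<^sub>L real"
  obtain v where "\<And>f. g (T f) = blinfun_apply f v"
    using assms by blast
  then show "continuous_map weak_star_topology euclideanreal (\<lambda>f. g (T f))"
    using strong_operator_topology_continuous_evaluation[of v]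
    by (simp add: weak_star_topology_def)
qed

text \<open>The elementary tensor of \<open>x\<close> and \<open>y\<close>, acting on
  functionals.\<close>

definition rank_one :: "'a::real_normed_vector \<Rightarrow> 'b::real_normed_vector \<Rightarrow> ('a, 'b) wstar_op" where
  "rank_one x y = Wstar_op (Blinfun (\<lambda>f. blinfun_apply f x *\<^sub>R y))"

lemma op_of_rank_one:
  fixes x :: "'a::real_normed_vector" and y :: "'b::real_normed_vector"
  shows "blinfun_apply (op_of (rank_one x y)) f = blinfun_apply f x *\<^sub>R y"
proof -
  have bl: "bounded_linear (\<lambda>f. blinfun_apply f x *\<^sub>R y)"
    by (rule bounded_linear_compose[OF bounded_linear_scaleR_left blinfun.bounded_linear_left])
  have "wstar_weak_continuous (Blinfun (\<lambda>f. blinfun_apply f x *\<^sub>R y))"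
  proof (rule wstar_weak_continuousI)
    fix g :: "'b \<Rightarrow>\<^sub>L real"
    show "\<exists>v. \<forall>f. g (blinfun_apply (Blinfun (\<lambda>f. blinfun_apply f x *\<^sub>R y)) f) = blinfun_apply f v"
      by (rule exI[of _ "g y *\<^sub>R x"])
        (simp add: bounded_linear_Blinfun_apply[OF bl] blinfun.bilinear_simps)
  qed
  then show ?thesis
    by (simp add: rank_one_def op_of_Wstar_op bounded_linear_Blinfun_apply[OF bl])
qed

lemma wstar_op_eqI:
  assumes "\<And>f. blinfun_apply (op_of S) f = blinfun_apply (op_of T) f"
  shows "S = T"
  using assms op_of_inject blinfun_eqI by blast

lemma norm_rank_one:
  fixes x :: "'a::real_normed_vector" and y :: "'b::real_normed_vector"
  shows "norm (rank_one x y) = norm x * norm y"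
proof (rule antisym)
  have "norm (f x *\<^sub>R y) \<le> norm x * norm y * norm f" for f :: "'a \<Rightarrow>\<^sub>L real"
    using mult_right_mono[OF norm_blinfun[of f x] norm_ge_zero[of y]] by (simp add: ac_simps)
  then show "norm (rank_one x y) \<le> norm x * norm y"
    by (auto simp: norm_wstar_op_def op_of_rank_one intro!: norm_blinfun_bound)
  obtain f :: "'a \<Rightarrow>\<^sub>L real" where f: "f x = norm x" "norm f \<le> 1"
    by (rule norming_functional)
  have "norm x * norm y = norm (op_of (rank_one x y) f)"
    by (simp add: op_of_rank_one f)
  also have "\<dots> \<le> norm (rank_one x y) * norm f"
    unfolding norm_wstar_op_def by (rule norm_blinfun)
  also have "\<dots> \<le> norm (rank_one x y)"
    using f(2) by (simp add: mult_left_le)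
  finally show "norm x * norm y \<le> norm (rank_one x y)" .
qed

lemma bounded_linear_rank_one_left: "bounded_linear (\<lambda>x. rank_one x y)"
  by (rule bounded_linear_intro[of _ "norm y"])
    (auto intro!: wstar_op_eqI simp: op_of_rank_one op_of_simps blinfun.bilinear_simps
      scaleR_left_distrib norm_rank_one)

lemma bounded_linear_rank_one_right: "bounded_linear (\<lambda>y. rank_one x y)"
  by (rule bounded_linear_intro[of _ "norm x"])
    (auto intro!: wstar_op_eqI simp: op_of_rank_one op_of_simps blinfun.bilinear_simps
      scaleR_right_distrib norm_rank_one)

lemma exists_norm_one:
  assumes "(UNIV :: 'a::real_normed_vector set) \<noteq> {0}"
  obtains x :: "'a::real_normed_vector" where "norm x = 1"
proof -
  obtain z :: 'a where "z \<noteq> 0"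
    using assms by auto
  then show thesis
    using that[of "sgn z"] by (simp add: norm_sgn)
qed

section \<open>Phillips' lemma\<close>

text \<open>A signed finitely additive measure on the full power set; the case
  \<open>A = B = {}\<close> already gives the value 0 at the empty set.\<close>

definition finitely_additive :: "('k set \<Rightarrow> real) \<Rightarrow> bool" where
  "finitely_additive \<mu> \<longleftrightarrow> (\<forall>A B. A \<inter> B = {} \<longrightarrow> \<mu> (A \<union> B) = \<mu> A + \<mu> B)"

lemma finitely_additive_UN:
  assumes \<mu>: "finitely_additive \<mu>" and "finite R" and "disjoint_family_on B R"
  shows "\<mu> (\<Union>r\<in>R. B r) = (\<Sum>r\<in>R. \<mu> (B r))"
  using assms(2,3)
proof (induction R)
  case empty
  have "\<mu> ({} \<union> {}) = \<mu> {} + \<mu> {}"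
    using \<mu> unfolding finitely_additive_def by blast
  then show ?case by simp
next
  case (insert r R)
  have "disjoint_family_on B R"
    using insert.prems by (auto simp: disjoint_family_on_def)
  moreover have "B r \<inter> (\<Union>s\<in>R. B s) = {}"
    using insert.prems insert.hyps by (auto simp: disjoint_family_on_def)
  ultimately show ?case
    using insert \<mu> by (simp add: finitely_additive_def)
qed

text \<open>Splitting \<open>R\<close> by the sign of \<open>\<mu> (B r)\<close> turns each half of
  the sum into plus or minus the measure of a single union, and each of these is at most
  \<open>C\<close>.\<close>

lemma finitely_additive_sum_abs_le:
  assumes \<mu>: "finitely_additive \<mu>" and bd: "\<And>A. \<bar>\<mu> A\<bar> \<le> C"
    and R: "finite R" and B: "disjoint_family_on B R"
  shows "(\<Sum>r\<in>R. \<bar>\<mu> (B r)\<bar>) \<le> 2 * C"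
proof -
  define P where "P = {r\<in>R. 0 \<le> \<mu> (B r)}"
  have P: "P \<subseteq> R" "finite P" "disjoint_family_on B P" "disjoint_family_on B (R - P)"
    using R B by (auto simp: P_def disjoint_family_on_def)
  have "(\<Sum>r\<in>R. \<bar>\<mu> (B r)\<bar>) = (\<Sum>r\<in>R - P. \<bar>\<mu> (B r)\<bar>) + (\<Sum>r\<in>P. \<bar>\<mu> (B r)\<bar>)"
    using P R by (simp add: sum.subset_diff)
  also have "\<dots> = - (\<Sum>r\<in>R - P. \<mu> (B r)) + (\<Sum>r\<in>P. \<mu> (B r))"
    unfolding sum_negf[symmetric] by (intro arg_cong2[of _ _ _ _ "(+)"] sum.cong) (auto simp: P_def)
  also have "\<dots> = - \<mu> (\<Union>r\<in>R - P. B r) + \<mu> (\<Union>r\<in>P. B r)"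
    using finitely_additive_UN[OF \<mu> _ P(3)] finitely_additive_UN[OF \<mu> _ P(4)] P(2) R by simp
  also have "\<dots> \<le> 2 * C"
    using bd[of "\<Union>r\<in>R - P. B r"] bd[of "\<Union>r\<in>P. B r"] by linarith
  finally show ?thesis .
qed

text \<open>Numbering \<open>M\<close> by pairs through \<open>prod_encode\<close> splits off
  infinitely many disjoint infinite rows \<open>S r\<close>. If every row had a subset of measure
  above \<open>d\<close> in absolute value, sufficiently many of these would violate the variation
  bound \<open>2 * C\<close>.\<close>

lemma finitely_additive_small_on_infinite_subset:
  fixes \<mu> :: "nat set \<Rightarrow> real"
  assumes \<mu>: "finitely_additive \<mu>" and bd: "\<And>A. \<bar>\<mu> A\<bar> \<le> C"
    and M: "infinite M" and d: "d > 0"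
  shows "\<exists>M'\<subseteq>M. infinite M' \<and> (\<forall>B\<subseteq>M'. \<bar>\<mu> B\<bar> \<le> d)"
proof (rule ccontr)
  assume no_subset: "\<not> ?thesis"
  have neg: "\<exists>B\<subseteq>M'. d < \<bar>\<mu> B\<bar>" if "M' \<subseteq> M" "infinite M'" for M'
  proof (rule ccontr)
    assume "\<not> (\<exists>B\<subseteq>M'. d < \<bar>\<mu> B\<bar>)"
    then have "\<forall>B\<subseteq>M'. \<bar>\<mu> B\<bar> \<le> d" by (simp add: not_less)
    with that no_subset show False by blast
  qed
  define S where "S r = range (\<lambda>j. enumerate M (prod_encode (r, j)))" for r
  have inj: "enumerate M i = enumerate M j \<longleftrightarrow> i = j" for i j
    using M strict_mono_enumerate strict_mono_eq by blast
  have SM: "S r \<subseteq> M" for r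
    using enumerate_in_set[OF M] by (auto simp: S_def)
  have inf_S: "infinite (S r)" for r
    unfolding S_def by (rule range_inj_infinite) (simp add: inj_def inj)
  have "\<forall>r. \<exists>B. B \<subseteq> S r \<and> d < \<bar>\<mu> B\<bar>"
    using neg[OF SM inf_S] by simp
  from choice[OF this] obtain B where B: "\<And>r. B r \<subseteq> S r" "\<And>r. d < \<bar>\<mu> (B r)\<bar>"
    by blast
  have "disjoint_family S"
    by (auto simp: S_def disjoint_family_on_def inj)
  then have dB: "disjoint_family_on B R" for R
    using B(1) unfolding disjoint_family_on_def by blast
  have "(\<Sum>r<N. \<bar>\<mu> (B r)\<bar>) \<le> 2 * C" for N :: nat
    by (rule finitely_additive_sum_abs_le[OF \<mu> bd _ dB]) simp
  moreover have "real N * d \<le> (\<Sum>r<N. \<bar>\<mu> (B r)\<bar>)" for N :: nat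
    using sum_mono[of "{..<N}" "\<lambda>_. d"] B(2) by (simp add: less_imp_le)
  ultimately have "real N * d \<le> 2 * C" for N :: nat
    using order_trans by blast
  moreover obtain N :: nat where "2 * C < real N * d"
    using d reals_Archimedean3 by blast
  ultimately show False
    by (meson not_le)
qed

text \<open>A gliding hump on sets of positions: \<open>F\<close> collects the positions \<open>\<kappa> n\<close> chosen so far, and \<open>M\<close> is
  an infinite reservoir on whose subsets the measures already used are small. Along the chosen
  indices \<open>n\<close>, the value at the union of the \<open>F\<close> then stays away from \<open>0\<close>.\<close>

lemma phillips:
  fixes \<mu> :: "nat \<Rightarrow> nat set \<Rightarrow> real"
  assumes add: "\<And>n. finitely_additive (\<mu> n)" and bd: "\<And>n A. \<bar>\<mu> n A\<bar> \<le> C n"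
    and null: "\<And>A. (\<lambda>n. \<mu> n A) \<longlonglongrightarrow> 0" and e: "e > 0"
  shows "eventually (\<lambda>n. \<forall>k. \<bar>\<mu> n {k}\<bar> \<le> e) sequentially"
proof (rule ccontr)
  assume not_ev: "\<not> ?thesis"
  define K where "K = {n. \<exists>k. e < \<bar>\<mu> n {k}\<bar>}"
  have K: "infinite K"
    using not_ev unfolding K_def eventually_sequentially infinite_nat_iff_unbounded_le
    by (auto simp: not_le)
  define \<kappa> where "\<kappa> n = (SOME k. e < \<bar>\<mu> n {k}\<bar>)" for n
  have \<kappa>: "e < \<bar>\<mu> n {\<kappa> n}\<bar>" if "n \<in> K" for n
    using that someI_ex[of "\<lambda>k. e < \<bar>\<mu> n {k}\<bar>"] by (simp add: K_def \<kappa>_def)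
  have small: "eventually (\<lambda>n. \<bar>\<mu> n A\<bar> < d) sequentially" if "d > 0" for A d
    using null[of A] that by (simp add: tendsto_iff)
  \<comment> \<open>Otherwise a single \<open>k\<close> would be chosen for infinitely many
    \<open>n\<close>, against the convergence of \<open>\<mu> n {k}\<close> to 0.\<close>
  have "infinite (\<kappa> ` K)"
  proof
    assume "finite (\<kappa> ` K)"
    then obtain k where k: "infinite {n\<in>K. \<kappa> n = k}"
      using pigeonhole_infinite[OF K] by (metis (mono_tags, lifting) Collect_cong)
    have "eventually (\<lambda>n. \<bar>\<mu> n {k}\<bar> < e) sequentially"
      using small e .
    then obtain N where N: "\<And>n. n \<ge> N \<Longrightarrow> \<bar>\<mu> n {k}\<bar> < e"
      unfolding eventually_sequentially by blast
    obtain n where "n \<ge> N" "n \<in> K" "\<kappa> n = k"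
      using k unfolding infinite_nat_iff_unbounded_le by blast
    then show False
      using N[of n] \<kappa>[of n] by simp
  qed
  \<comment> \<open>Error budget: at most \<open>e / 4\<close> for the positions other than
    \<open>\<kappa> n\<close> in \<open>F\<close>, and at most \<open>e / 4\<close> for whatever is
    picked from \<open>M\<close> later. Against the hump of size above \<open>e\<close> at
    \<open>\<kappa> n\<close>, at least \<open>e / 2\<close> survives.\<close>
  define P where "P = (\<lambda>(n, F, M). n \<in> K \<and> \<kappa> n \<in> F \<and> finite F \<and> infinite M \<and> M \<subseteq> \<kappa> ` K \<and>
    F \<inter> M = {} \<and> \<bar>\<mu> n (F - {\<kappa> n})\<bar> \<le> e / 4 \<and> (\<forall>B\<subseteq>M. \<bar>\<mu> n B\<bar> \<le> e / 4))"
  have step: "\<exists>n' F' M'. P (n', F', M') \<and> n < n' \<and> F \<subseteq> F' \<and> F' \<subseteq> F \<union> M \<and> M' \<subseteq> M"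
    if F: "finite F" and M: "infinite M" "M \<subseteq> \<kappa> ` K" "F \<inter> M = {}" for n F M
  proof -
    have "eventually (\<lambda>n. \<bar>\<mu> n F\<bar> < e / 4) sequentially"
      using small[of "e / 4"] e by simp
    then obtain N where N: "\<And>n. n \<ge> N \<Longrightarrow> \<bar>\<mu> n F\<bar> < e / 4"
      unfolding eventually_sequentially by blast
    have "infinite {n\<in>K. \<kappa> n \<in> M}"
    proof
      assume "finite {n\<in>K. \<kappa> n \<in> M}"
      moreover have "M \<subseteq> \<kappa> ` {n\<in>K. \<kappa> n \<in> M}"
        using M(2) by auto
      ultimately show False
        using M(1) finite_surj by blast
    qed
    then obtain n' where n': "n' \<ge> max N (Suc n)" "n' \<in> K" "\<kappa> n' \<in> M"
      unfolding infinite_nat_iff_unbounded_le by blast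
    \<comment> \<open>The new position is taken out of the reservoir first, so that the enlarged
      \<open>F\<close> stays disjoint from it.\<close>
    obtain M' where M': "M' \<subseteq> M - {\<kappa> n'}" "infinite M'" "\<And>B. B \<subseteq> M' \<Longrightarrow> \<bar>\<mu> n' B\<bar> \<le> e / 4"
      using finitely_additive_small_on_infinite_subset[OF add[of n'] bd[of n'], of "M - {\<kappa> n'}" "e / 4"]
        M(1) e by auto
    have "F - {\<kappa> n'} = F"
      using F n' M by blast
    then have "P (n', insert (\<kappa> n') F, M')"
      using n' M M' F less_imp_le[OF N[of n']] by (auto simp: P_def insert_Diff_if)
    then show ?thesis
      using n' M' by (intro exI[of _ n'] exI[of _ "insert (\<kappa> n') F"] exI[of _ M']) auto
  qed
  define Q where "Q = (\<lambda>(n::nat, F::nat set, M::nat set) (n', F', M').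
    n < n' \<and> F \<subseteq> F' \<and> F' \<subseteq> F \<union> M \<and> M' \<subseteq> M)"
  have "\<exists>s. P s"
    using step[of "{}" "\<kappa> ` K" 0] \<open>infinite (\<kappa> ` K)\<close> by blast
  moreover have "\<exists>t. P t \<and> Q s t" if "P s" for s
  proof -
    obtain n F M where s: "s = (n, F, M)"
      using prod_cases3 by blast
    have "finite F" "infinite M" "M \<subseteq> \<kappa> ` K" "F \<inter> M = {}"
      using that by (auto simp: s P_def)
    from step[OF this, of n] obtain n' F' M'
      where "P (n', F', M')" "n < n'" "F \<subseteq> F'" "F' \<subseteq> F \<union> M" "M' \<subseteq> M"
      by blast
    then show ?thesis
      by (intro exI[of _ "(n', F', M')"]) (simp add: s Q_def)
  qed
  ultimately have "\<exists>s. \<forall>i. P (s i) \<and> Q (s i) (s (Suc i))"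
    by (rule dependent_nat_choice)
  then obtain s where s: "\<And>i. P (s i)" "\<And>i. Q (s i) (s (Suc i))"
    by blast
  define n F M where "n i = fst (s i)" and "F i = fst (snd (s i))" and "M i = snd (snd (s i))" for i
  have s_eq: "s i = (n i, F i, M i)" for i
    by (simp add: n_def F_def M_def)
  note P = s(1)[unfolded s_eq P_def prod.case]
  note Q = s(2)[unfolded s_eq Q_def prod.case]
  have n: "strict_mono n"
    using Q by (simp add: strict_mono_Suc_iff)
  have F_mono: "F i \<subseteq> F j" if "i \<le> j" for i j
    using lift_Suc_mono_le[of F] Q that by blast
  have M_mono: "M j \<subseteq> M i" if "i \<le> j" for i j
    using lift_Suc_antimono_le[of M] Q that by blast
  \<comment> \<open>Every position chosen after stage \<open>i\<close> comes from the reservoir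
    \<open>M i\<close>, where \<open>\<mu> (n i)\<close> is small.\<close>
  have F_sub: "F j \<subseteq> F i \<union> M i" if "i \<le> j" for i j
    using that
  proof (induction j rule: dec_induct)
    case (step j)
    then show ?case using Q[of j] M_mono[of i j] by blast
  qed simp
  define A where "A = (\<Union>i. F i)"
  \<comment> \<open>\<open>A\<close> splits into the hump \<open>\<kappa> (n i)\<close>, the other
    positions in \<open>F i\<close>, and a remainder inside \<open>M i\<close>; the last two
    contribute at most \<open>e / 4\<close> each.\<close>
  have big: "e / 2 \<le> \<bar>\<mu> (n i) A\<bar>" for i
  proof -
    have "A - F i \<subseteq> M i"
    proof
      fix k assume k: "k \<in> A - F i"
      then obtain j where "k \<in> F j"
        by (auto simp: A_def)
      then show "k \<in> M i"
        using k F_mono[of j i] F_sub[of i j] by (cases "i \<le> j") auto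
    qed
    then have 1: "\<bar>\<mu> (n i) (A - F i)\<bar> \<le> e / 4"
      using P by blast
    have "A = F i \<union> (A - F i)" "F i = {\<kappa> (n i)} \<union> (F i - {\<kappa> (n i)})"
      using P[of i] by (auto simp: A_def)
    then have "\<mu> (n i) A = \<mu> (n i) (F i) + \<mu> (n i) (A - F i)"
      "\<mu> (n i) (F i) = \<mu> (n i) {\<kappa> (n i)} + \<mu> (n i) (F i - {\<kappa> (n i)})"
      using add[of "n i"] unfolding finitely_additive_def by (metis Diff_disjoint)+
    then show ?thesis
      using 1 P[of i] \<kappa>[of "n i"] by linarith
  qed
  have "(\<lambda>i. \<mu> (n i) A) \<longlonglongrightarrow> 0"
    using LIMSEQ_subseq_LIMSEQ[OF null n] by (simp add: o_def)
  then have "eventually (\<lambda>i. \<bar>\<mu> (n i) A\<bar> < e / 2) sequentially"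
    using e by (auto dest: tendstoD[of _ _ _ "e / 2"])
  then show False
    using big by (meson eventually_happens' not_le sequentially_bot)
qed

section \<open>Sequences with an upper \<open>\<ell>\<^sub>2\<close> estimate\<close>

lemma ell_2_iff: "a \<in> ell 2 \<longleftrightarrow> summable (\<lambda>n. (a n)\<^sup>2)"
  by (simp add: ell_def)

lemma ell_norm_2: "a \<in> ell 2 \<Longrightarrow> ell_norm 2 a = sqrt (\<Sum>n. (a n)\<^sup>2)"
  by (simp add: ell_norm_def ell_2_iff powr_half_sqrt suminf_nonneg)

lemma ell_finite_support: "finite F \<Longrightarrow> (\<lambda>n. if n \<in> F then a n else 0) \<in> ell p"
  unfolding ell_def by (auto intro!: summable_finite[of F])

lemma ell_norm_finite_support:
  "finite F \<Longrightarrow> ell_norm p (\<lambda>n. if n \<in> F then a n else 0) = (\<Sum>n\<in>F. \<bar>a n\<bar> powr p) powr (1 / p)"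
  unfolding ell_norm_def by (subst suminf_finite[of F]) auto

text \<open>\<open>ell p\<close> is only a set of functions, not a vector space type, so linearity
  of \<open>T\<close> on finite combinations of unit vectors is obtained by induction on the
  support.\<close>

lemma ell_embedding_finite_support:
  fixes T :: "(nat \<Rightarrow> real) \<Rightarrow> 'a::real_vector"
  assumes add: "\<And>a b. a \<in> ell p \<Longrightarrow> b \<in> ell p \<Longrightarrow> T (\<lambda>n. a n + b n) = T a + T b"
    and scale: "\<And>a r. a \<in> ell p \<Longrightarrow> T (\<lambda>n. r * a n) = r *\<^sub>R T a"
    and "finite F"
  shows "T (\<lambda>n. if n \<in> F then a n else 0) = (\<Sum>k\<in>F. a k *\<^sub>R T (\<lambda>n. if n = k then 1 else 0))"
  using assms(3)
proof (induction F)
  case empty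
  show ?case
    using scale[of "\<lambda>_. 0" 0] ell_finite_support[of "{}" _ p] by simp
next
  case (insert k F)
  have e: "(\<lambda>n. if n = k then 1 else 0) \<in> ell p" (is "?e \<in> _")
    using ell_finite_support[of "{k}" "\<lambda>_. 1" p] by simp
  have ae: "(\<lambda>n. a k * ?e n) \<in> ell p"
    unfolding ell_def by (auto intro!: summable_finite[of "{k}"] split: if_splits)
  have "(\<lambda>n. if n \<in> insert k F then a n else 0) = (\<lambda>n. a k * ?e n + (if n \<in> F then a n else 0))"
    using insert.hyps by auto
  then have "T (\<lambda>n. if n \<in> insert k F then a n else 0)
      = a k *\<^sub>R T ?e + T (\<lambda>n. if n \<in> F then a n else 0)"
    using add[OF ae ell_finite_support[OF insert.hyps(1)], of a]
    unfolding scale[OF e, of "a k"] by argo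
  then show ?case
    by (simp only: insert.IH sum.insert[OF insert.hyps])
qed

text \<open>Means that the unit vectors of \<open>ell 2\<close> are sent to the \<open>x k\<close>
  by an operator of norm at most \<open>C\<close>. Arbitrary finite sets are allowed so that Cauchy
  blocks \<open>{m..<n}\<close> are covered directly.\<close>

definition upper_l2_bound :: "real \<Rightarrow> (nat \<Rightarrow> 'a::real_normed_vector) \<Rightarrow> bool" where
  "upper_l2_bound C x \<longleftrightarrow> 0 \<le> C \<and>
    (\<forall>F a. finite F \<longrightarrow> norm (\<Sum>k\<in>F. a k *\<^sub>R x k) \<le> C * sqrt (\<Sum>k\<in>F. (a k)\<^sup>2))"

text \<open>The body of \<open>ell_embeds\<close> with its witnesses turned into parameters, so that
  the single properties can be extracted by name.\<close>

definition ell_embedding ::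
  "real \<Rightarrow> 'a::real_normed_vector set \<Rightarrow> ((nat \<Rightarrow> real) \<Rightarrow> 'a) \<Rightarrow> real \<Rightarrow> real \<Rightarrow> bool"
where
  "ell_embedding p M T c C \<longleftrightarrow> subspace M \<and> closed M \<and> bij_betw T (ell p) M \<and>
    (\<forall>a\<in>ell p. \<forall>b\<in>ell p. T (\<lambda>n. a n + b n) = T a + T b) \<and>
    (\<forall>a\<in>ell p. \<forall>r. T (\<lambda>n. r * a n) = r *\<^sub>R T a) \<and>
    0 < c \<and> 0 < C \<and>
    (\<forall>a\<in>ell p. c * ell_norm p a \<le> norm (T a) \<and> norm (T a) \<le> C * ell_norm p a)"

lemma ell_embeds_iff: "ell_embeds p TYPE('a::real_normed_vector) \<longleftrightarrow> (\<exists>(M :: 'a set) T c C. ell_embedding p M T c C)"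
  by (simp only: ell_embeds_def ell_embedding_def)

lemma ell_embeddingD:
  assumes "ell_embedding p M T c C"
  shows "subspace M" "closed M" "bij_betw T (ell p) M" "0 < c" "0 < C"
    and "\<And>a b. a \<in> ell p \<Longrightarrow> b \<in> ell p \<Longrightarrow> T (\<lambda>n. a n + b n) = T a + T b"
    and "\<And>a r. a \<in> ell p \<Longrightarrow> T (\<lambda>n. r * a n) = r *\<^sub>R T a"
    and "\<And>a. a \<in> ell p \<Longrightarrow> c * ell_norm p a \<le> norm (T a)"
    and "\<And>a. a \<in> ell p \<Longrightarrow> norm (T a) \<le> C * ell_norm p a"
  using assms by (simp_all add: ell_embedding_def)

lemma ell_2_embeds_basis:
  assumes "ell_embeds 2 TYPE('a::real_normed_vector)"
  shows "\<exists>(x :: nat \<Rightarrow> 'a) c C. 0 < c \<and> (\<forall>k. c \<le> norm (x k)) \<and> upper_l2_bound C x"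
proof -
  obtain M :: "'a set" and T c C where T: "ell_embedding 2 M T c C"
    using assms unfolding ell_embeds_iff by (elim exE)
  note c = ell_embeddingD(4)[OF T] and C = ell_embeddingD(5)[OF T]
    and add = ell_embeddingD(6)[OF T] and scale = ell_embeddingD(7)[OF T]
    and bd = ell_embeddingD(8,9)[OF T]
  define x where "x k = T (\<lambda>n. if n = k then 1 else 0)" for k
  show ?thesis
  proof (intro exI conjI allI)
    show "0 < c" by fact
    show "c \<le> norm (x k)" for k
      using bd(1)[of "\<lambda>n. if n = k then 1 else 0"] ell_finite_support[of "{k}" "\<lambda>_. 1" 2]
        ell_norm_finite_support[of "{k}" 2 "\<lambda>_. 1"] by (simp add: x_def)
    show "upper_l2_bound C x"
      unfolding upper_l2_bound_def
    proof (intro conjI allI impI)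
      fix F :: "nat set" and a :: "nat \<Rightarrow> real" assume F: "finite F"
      have "norm (\<Sum>k\<in>F. a k *\<^sub>R x k) = norm (T (\<lambda>n. if n \<in> F then a n else 0))"
        unfolding x_def
        by (rule arg_cong[OF ell_embedding_finite_support[of 2 T, OF add scale F, symmetric]])
      also have "\<dots> \<le> C * sqrt (\<Sum>k\<in>F. (a k)\<^sup>2)"
        using bd(2)[OF ell_finite_support[OF F], of a] ell_norm_finite_support[OF F, of 2 a]
        by (simp add: powr_half_sqrt sum_nonneg)
      finally show "norm (\<Sum>k\<in>F. a k *\<^sub>R x k) \<le> C * sqrt (\<Sum>k\<in>F. (a k)\<^sup>2)" .
    qed (use C in simp)
  qed
qed

lemma upper_l2_bound_summable:
  fixes x :: "nat \<Rightarrow> 'a::banach"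
  assumes x: "upper_l2_bound C x" and a: "summable (\<lambda>k. (a k)\<^sup>2)"
  shows "summable (\<lambda>k. a k *\<^sub>R x k)"
  unfolding summable_Cauchy
proof (intro allI impI)
  fix e :: real assume e: "e > 0"
  have C: "0 \<le> C" and bd: "\<And>F. finite F \<Longrightarrow> norm (\<Sum>k\<in>F. a k *\<^sub>R x k) \<le> C * sqrt (\<Sum>k\<in>F. (a k)\<^sup>2)"
    using x by (auto simp: upper_l2_bound_def)
  \<comment> \<open>\<open>C + 1\<close> in place of \<open>C\<close> avoids division by zero and
    makes the final inequality strict.\<close>
  have d: "(e / (C + 1))\<^sup>2 > 0"
    using e C by simp
  then obtain N where N: "\<And>m n. m \<ge> N \<Longrightarrow> norm (\<Sum>k=m..<n. (a k)\<^sup>2) < (e / (C + 1))\<^sup>2"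
    using a unfolding summable_Cauchy by blast
  have "norm (\<Sum>k=m..<n. a k *\<^sub>R x k) < e" if "m \<ge> N" for m n
  proof -
    have "sqrt (\<Sum>k=m..<n. (a k)\<^sup>2) \<le> e / (C + 1)"
      using N[OF that, of n] e C by (intro real_le_lsqrt) (auto simp: sum_nonneg)
    then have "norm (\<Sum>k=m..<n. a k *\<^sub>R x k) \<le> C * (e / (C + 1))"
      using bd[of "{m..<n}"] C by (meson finite_atLeastLessThan mult_left_mono order_trans)
    also have "\<dots> < e"
      using e C by (simp add: field_simps)
    finally show ?thesis .
  qed
  then show "\<exists>N. \<forall>m\<ge>N. \<forall>n. norm (\<Sum>k=m..<n. a k *\<^sub>R x k) < e"
    by blast
qed

lemma upper_l2_bound_suminf:
  fixes x :: "nat \<Rightarrow> 'a::banach"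
  assumes x: "upper_l2_bound C x" and a: "summable (\<lambda>k. (a k)\<^sup>2)"
  shows "norm (\<Sum>k. a k *\<^sub>R x k) \<le> C * sqrt (\<Sum>k. (a k)\<^sup>2)"
proof (rule LIMSEQ_le)
  show "(\<lambda>n. norm (\<Sum>k<n. a k *\<^sub>R x k)) \<longlonglongrightarrow> norm (\<Sum>k. a k *\<^sub>R x k)"
    by (intro tendsto_norm summable_LIMSEQ upper_l2_bound_summable[OF x a])
  show "(\<lambda>n. C * sqrt (\<Sum>k<n. (a k)\<^sup>2)) \<longlonglongrightarrow> C * sqrt (\<Sum>k. (a k)\<^sup>2)"
    by (intro tendsto_intros summable_LIMSEQ a)
  show "\<exists>N. \<forall>n\<ge>N. norm (\<Sum>k<n. a k *\<^sub>R x k) \<le> C * sqrt (\<Sum>k<n. (a k)\<^sup>2)"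
    using x by (simp add: upper_l2_bound_def)
qed

text \<open>The adjoint of the operator from \<open>ell 2\<close> sends \<open>f\<close> to the
  sequence of the \<open>f (x k)\<close>. Concretely, the estimate is tested on the coefficients
  \<open>f (x k)\<close> themselves: their sum of squares \<open>s\<close> satisfies
  \<open>s \<le> norm f * C * sqrt s\<close>, and \<open>sqrt s\<close> cancels.\<close>

lemma upper_l2_bound_functional:
  fixes x :: "nat \<Rightarrow> 'a::real_normed_vector" and f :: "'a \<Rightarrow>\<^sub>L real"
  assumes x: "upper_l2_bound C x"
  shows "summable (\<lambda>k. (f (x k))\<^sup>2)" "sqrt (\<Sum>k. (f (x k))\<^sup>2) \<le> C * norm f"
proof -
  have C: "0 \<le> C"
    using x by (simp add: upper_l2_bound_def)
  have bd: "(\<Sum>k<n. (f (x k))\<^sup>2) \<le> (C * norm f)\<^sup>2" for n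
  proof -
    define s where "s = (\<Sum>k<n. (f (x k))\<^sup>2)"
    have s: "0 \<le> s" by (simp add: s_def sum_nonneg)
    have "s = f (\<Sum>k<n. f (x k) *\<^sub>R x k)"
      by (simp add: s_def blinfun.sum_right blinfun.scaleR_right power2_eq_square)
    also have "\<dots> \<le> norm f * norm (\<Sum>k<n. f (x k) *\<^sub>R x k)"
      using norm_blinfun[of f] by (metis abs_le_D1 real_norm_def)
    also have "\<dots> \<le> norm f * (C * sqrt s)"
      using x unfolding upper_l2_bound_def s_def by (intro mult_left_mono) auto
    finally have "sqrt s * sqrt s \<le> (C * norm f) * sqrt s"
      using s by (simp add: ac_simps)
    then have "sqrt s \<le> C * norm f"
      using s C mult_right_le_imp_le[of "sqrt s" "sqrt s"] by (cases "s = 0") auto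
    then show ?thesis
      using s unfolding s_def[symmetric] by (metis real_sqrt_ge_zero real_sqrt_pow2 power_mono)
  qed
  show sm: "summable (\<lambda>k. (f (x k))\<^sup>2)"
    by (rule summableI_nonneg_bounded[where x = "(C * norm f)\<^sup>2"]) (use bd in auto)
  have "(\<Sum>k. (f (x k))\<^sup>2) \<le> (C * norm f)\<^sup>2"
    by (rule suminf_le_const[OF sm bd])
  then show "sqrt (\<Sum>k. (f (x k))\<^sup>2) \<le> C * norm f"
    using C by (simp add: real_le_lsqrt)
qed

section \<open>Diagonal operators\<close>

definition diag_op ::
  "(nat \<Rightarrow> 'a::real_normed_vector) \<Rightarrow> (nat \<Rightarrow> 'b::real_normed_vector) \<Rightarrow> nat set \<Rightarrow> ('a, 'b) wstar_op"
where
  "diag_op x y A = Wstar_op (Blinfun (\<lambda>f. \<Sum>k. (indicator A k * blinfun_apply f (x k)) *\<^sub>R y k))"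

context
  fixes x :: "nat \<Rightarrow> 'a::banach" and y :: "nat \<Rightarrow> 'b::banach" and C D :: real
  assumes x: "upper_l2_bound C x" and y: "upper_l2_bound D y"
begin

lemma summable_indicator_sq:
  "summable (\<lambda>k. (a k)\<^sup>2) \<Longrightarrow> summable (\<lambda>k. (indicator A k * a k :: real)\<^sup>2)"
  by (rule summable_comparison_test'[of _ 0]) (auto simp: indicator_def)

lemma diag_op_summable: "summable (\<lambda>k. (indicator A k * blinfun_apply f (x k)) *\<^sub>R y k)"
  by (intro upper_l2_bound_summable[OF y] summable_indicator_sq upper_l2_bound_functional[OF x])

text \<open>The upper estimate for \<open>y\<close> is applied to the coefficients
  \<open>f (x k)\<close>, whose \<open>ell 2\<close> norm is at most \<open>C * norm f\<close> by
  duality. Restriction to \<open>A\<close> only shrinks the coefficients, so the bound is uniform in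
  \<open>A\<close>.\<close>

lemma diag_op_bound:
  "norm (\<Sum>k. (indicator A k * blinfun_apply f (x k)) *\<^sub>R y k) \<le> C * D * norm f"
proof -
  have fx: "summable (\<lambda>k. (f (x k))\<^sup>2)"
    by (rule upper_l2_bound_functional[OF x])
  have D: "0 \<le> D" using y by (simp add: upper_l2_bound_def)
  have "norm (\<Sum>k. (indicator A k * blinfun_apply f (x k)) *\<^sub>R y k)
      \<le> D * sqrt (\<Sum>k. (indicator A k * blinfun_apply f (x k))\<^sup>2)"
    by (intro upper_l2_bound_suminf[OF y] summable_indicator_sq fx)
  also have "\<dots> \<le> D * sqrt (\<Sum>k. (f (x k))\<^sup>2)"
    by (intro mult_left_mono D real_sqrt_le_mono suminf_le summable_indicator_sq fx)
      (auto simp: indicator_def)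
  also have "\<dots> \<le> D * (C * norm f)"
    by (intro mult_left_mono D upper_l2_bound_functional[OF x])
  finally show ?thesis by (simp add: ac_simps)
qed

lemma bounded_linear_diag_op:
  "bounded_linear (\<lambda>f. \<Sum>k. (indicator A k * blinfun_apply f (x k)) *\<^sub>R y k)"
proof (rule bounded_linear_intro[of _ "C * D"])
  fix f g :: "'a \<Rightarrow>\<^sub>L real" and r :: real
  show "(\<Sum>k. (indicator A k * (f + g) (x k)) *\<^sub>R y k) =
      (\<Sum>k. (indicator A k * f (x k)) *\<^sub>R y k) + (\<Sum>k. (indicator A k * g (x k)) *\<^sub>R y k)"
    by (simp add: suminf_add diag_op_summable blinfun.bilinear_simps distrib_left scaleR_left_distrib)
  show "(\<Sum>k. (indicator A k * (r *\<^sub>R f) (x k)) *\<^sub>R y k) = r *\<^sub>R (\<Sum>k. (indicator A k * f (x k)) *\<^sub>R y k)"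
    by (simp add: suminf_scaleR_right[OF diag_op_summable] blinfun.bilinear_simps ac_simps)
  show "norm (\<Sum>k. (indicator A k * f (x k)) *\<^sub>R y k) \<le> norm f * (C * D)"
    using diag_op_bound[of A f] by (simp add: ac_simps)
qed

text \<open>For weak*-to-weak continuity the roles of \<open>x\<close> and \<open>y\<close> are
  exchanged: \<open>g\<close> of the series is \<open>f\<close> evaluated at the vector series with
  coefficients \<open>indicator A k * g (y k)\<close> along \<open>x\<close>, which converges by the
  same estimates.\<close>

lemma op_of_diag_op:
  "blinfun_apply (op_of (diag_op x y A)) f = (\<Sum>k. (indicator A k * blinfun_apply f (x k)) *\<^sub>R y k)"
proof -
  note apply_eq = bounded_linear_Blinfun_apply[OF bounded_linear_diag_op[of A]]
  let ?S = "\<lambda>f. \<Sum>k. (indicator A k * blinfun_apply f (x k)) *\<^sub>R y k"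
  have "wstar_weak_continuous (Blinfun ?S)"
  proof (rule wstar_weak_continuousI)
    fix g :: "'b \<Rightarrow>\<^sub>L real"
    have sm: "summable (\<lambda>k. (indicator A k * g (y k)) *\<^sub>R x k)"
      by (intro upper_l2_bound_summable[OF x] summable_indicator_sq upper_l2_bound_functional[OF y])
    have "g (\<Sum>k. (indicator A k * f (x k)) *\<^sub>R y k) = f (\<Sum>k. (indicator A k * g (y k)) *\<^sub>R x k)"
      for f :: "'a \<Rightarrow>\<^sub>L real"
      by (simp add: bounded_linear.suminf[OF blinfun.bounded_linear_right, OF diag_op_summable]
          bounded_linear.suminf[OF blinfun.bounded_linear_right, OF sm] blinfun.bilinear_simps ac_simps)
    then show "\<exists>v. \<forall>f. g (blinfun_apply (Blinfun ?S) f) = blinfun_apply f v"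
      unfolding apply_eq by blast
  qed
  then show ?thesis
    by (simp add: diag_op_def op_of_Wstar_op apply_eq)
qed

lemma norm_diag_op_le: "norm (diag_op x y A) \<le> C * D"
  unfolding norm_wstar_op_def
  by (rule norm_blinfun_bound) (use diag_op_bound x y in \<open>auto simp: op_of_diag_op upper_l2_bound_def\<close>)

lemma diag_op_Un:
  assumes "A \<inter> B = {}"
  shows "diag_op x y (A \<union> B) = diag_op x y A + diag_op x y B"
proof (rule wstar_op_eqI)
  fix f :: "'a \<Rightarrow>\<^sub>L real"
  have "indicator (A \<union> B) k = (indicator A k + indicator B k :: real)" for k
    using assms by (auto simp: indicator_def)
  then show "op_of (diag_op x y (A \<union> B)) f = op_of (diag_op x y A + diag_op x y B) f"
    by (simp add: op_of_diag_op op_of_add blinfun.bilinear_simps suminf_add diag_op_summable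
        distrib_right scaleR_left_distrib)
qed

lemma diag_op_singleton: "diag_op x y {k} = rank_one (x k) (y k)"
proof (rule wstar_op_eqI)
  fix f :: "'a \<Rightarrow>\<^sub>L real"
  have "(\<Sum>j. (indicator {k} j * f (x j)) *\<^sub>R y j) = (\<Sum>j\<in>{k}. (indicator {k} j * f (x j)) *\<^sub>R y j)"
    by (rule suminf_finite) (auto simp: indicator_def)
  then show "op_of (diag_op x y {k}) f = op_of (rank_one (x k) (y k)) f"
    by (simp add: op_of_diag_op op_of_rank_one)
qed

lemma finitely_additive_diag_op:
  fixes f :: "('a, 'b) wstar_op \<Rightarrow>\<^sub>L real"
  shows "finitely_additive (\<lambda>A. f (diag_op x y A))" "\<bar>f (diag_op x y A)\<bar> \<le> norm f * (C * D)"
proof -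
  show "finitely_additive (\<lambda>A. f (diag_op x y A))"
    by (simp add: finitely_additive_def diag_op_Un blinfun.add_right)
  have "\<bar>f (diag_op x y A)\<bar> \<le> norm f * norm (diag_op x y A)"
    using norm_blinfun[of f] by simp
  also have "\<dots> \<le> norm f * (C * D)"
    by (intro mult_left_mono norm_diag_op_le) simp
  finally show "\<bar>f (diag_op x y A)\<bar> \<le> norm f * (C * D)" .
qed

text \<open>The terms are the values of \<open>diag_op x y\<close> at singletons. A weak*-null
  sequence of functionals on the operator space induces finitely additive measures that tend to 0 at
  every set, and \<open>phillips\<close> makes the convergence uniform on singletons.\<close>

lemma limited_rank_one_basis: "limited (range (\<lambda>k. rank_one (x k) (y k)))"
  unfolding limited_iff
proof (intro conjI allI impI)
  show "bounded (range (\<lambda>k. rank_one (x k) (y k)))"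
    using norm_diag_op_le[of "{_}"] unfolding diag_op_singleton bounded_iff by blast
  fix f :: "nat \<Rightarrow> ('a, 'b) wstar_op \<Rightarrow>\<^sub>L real" and e :: real
  assume "\<forall>u. (\<lambda>n. f n u) \<longlonglongrightarrow> 0" "e > 0"
  then have "eventually (\<lambda>n. \<forall>k. \<bar>f n (diag_op x y {k})\<bar> \<le> e) sequentially"
    by (intro phillips[where C = "\<lambda>n. norm (f n) * (C * D)"] finitely_additive_diag_op) auto
  then show "eventually (\<lambda>n. \<forall>u\<in>range (\<lambda>k. rank_one (x k) (y k)). \<bar>f n u\<bar> \<le> e) sequentially"
    by (simp add: diag_op_singleton)
qed

text \<open>The variation bound over singletons gives summability for exponent 1; since the terms
  are at most \<open>M\<close>, larger exponents cost only the factor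
  \<open>M powr (p - 1)\<close>.\<close>

lemma weakly_summable_rank_one_basis:
  assumes p: "1 \<le> p"
  shows "weakly_summable p (\<lambda>k. rank_one (x k) (y k))"
  unfolding weakly_summable_def ell_def mem_Collect_eq
proof
  fix f :: "('a, 'b) wstar_op \<Rightarrow>\<^sub>L real"
  define M where "M = norm f * (C * D)"
  define b where "b k = \<bar>f (rank_one (x k) (y k))\<bar>" for k
  have bM: "b k \<le> M" for k
    using finitely_additive_diag_op(2)[of f "{k}"] by (simp add: b_def M_def diag_op_singleton)
  have "(\<Sum>k<n. b k) \<le> 2 * M" for n
    using finitely_additive_sum_abs_le[OF finitely_additive_diag_op(1,2), of "{..<n}" "\<lambda>k. {k}" f]
    by (simp add: b_def M_def diag_op_singleton disjoint_family_on_def)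
  then have "summable b"
    by (intro summableI_nonneg_bounded[where x = "2 * M"]) (auto simp: b_def)
  then have "summable (\<lambda>k. b k * M powr (p - 1))"
    by (rule summable_mult2)
  then show "summable (\<lambda>k. \<bar>f (rank_one (x k) (y k))\<bar> powr p)"
    unfolding b_def[symmetric]
  proof (rule summable_comparison_test'[of _ 0])
    fix k
    have "b k powr p = b k * b k powr (p - 1)"
      by (cases "b k = 0") (auto simp: b_def powr_mult_base)
    also have "\<dots> \<le> b k * M powr (p - 1)"
      using bM[of k] p by (intro mult_left_mono powr_mono2) (auto simp: b_def)
    finally show "norm (b k powr p) \<le> b k * M powr (p - 1)" by simp
  qed
qed

end

lemma not_both_ell_2_embed:
  assumes GP: "p_gelfand_phillips p TYPE(('a::banach, 'b::banach) wstar_op)" and p: "1 \<le> p"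
  shows "\<not> ell_embeds 2 TYPE('a) \<or> \<not> ell_embeds 2 TYPE('b)"
proof (rule ccontr)
  assume "\<not> ?thesis"
  then have 1: "ell_embeds 2 TYPE('a)" and 2: "ell_embeds 2 TYPE('b)" by auto
  obtain x :: "nat \<Rightarrow> 'a" and c C where x: "0 < c" "\<And>k. c \<le> norm (x k)" "upper_l2_bound C x"
    using ell_2_embeds_basis[OF 1] by blast
  obtain y :: "nat \<Rightarrow> 'b" and d D where y: "0 < d" "\<And>k. d \<le> norm (y k)" "upper_l2_bound D y"
    using ell_2_embeds_basis[OF 2] by blast
  have "(\<lambda>k. rank_one (x k) (y k)) \<longlonglongrightarrow> 0"
    using GP limited_rank_one_basis[OF x(3) y(3)] weakly_summable_rank_one_basis[OF x(3) y(3) p]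
    unfolding p_gelfand_phillips_def by blast
  from tendsto_norm_zero[OF this] have "(\<lambda>k. norm (x k) * norm (y k)) \<longlonglongrightarrow> 0"
    by (simp add: norm_rank_one)
  moreover have "c * d \<le> norm (x k) * norm (y k)" for k
    using x y by (intro mult_mono) auto
  ultimately have "c * d \<le> 0"
    by (intro LIMSEQ_le_const) auto
  then show False
    using x(1) y(1) by (simp add: mult_le_0_iff)
qed

section \<open>Khintchine's inequality\<close>

text \<open>A set \<open>t\<close> of naturals encodes a choice of signs: membership of
  \<open>k\<close> means that the \<open>k\<close>-th sign is positive.\<close>

definition rademacher :: "nat \<Rightarrow> nat set \<Rightarrow> real" where
  "rademacher k t = (if k \<in> t then 1 else - 1)"

text \<open>The expectation when the first \<open>m\<close> signs are independent and uniform and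
  all later ones are frozen at -1.\<close>

definition sign_avg :: "nat \<Rightarrow> (nat set \<Rightarrow> real) \<Rightarrow> real" where
  "sign_avg m F = (\<Sum>t\<in>Pow {..<m}. F t) / 2 ^ m"

lemma sign_avg_add: "sign_avg m (\<lambda>t. F t + G t) = sign_avg m F + sign_avg m G"
  by (simp add: sign_avg_def sum.distrib add_divide_distrib)

lemma sign_avg_cmult: "sign_avg m (\<lambda>t. c * F t) = c * sign_avg m F"
  by (simp add: sign_avg_def sum_distrib_left)

lemma sign_avg_const: "sign_avg m (\<lambda>t. c) = c"
  by (simp add: sign_avg_def card_Pow)

lemma sign_avg_mono:
  "(\<And>t. t \<subseteq> {..<m} \<Longrightarrow> F t \<le> G t) \<Longrightarrow> sign_avg m F \<le> sign_avg m G"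
  unfolding sign_avg_def by (intro divide_right_mono sum_mono) auto

lemma sign_avg_cong:
  "(\<And>t. t \<subseteq> {..<m} \<Longrightarrow> F t = G t) \<Longrightarrow> sign_avg m F = sign_avg m G"
  by (intro antisym sign_avg_mono) auto

lemma abs_sign_avg_le: "\<bar>sign_avg m F\<bar> \<le> sign_avg m (\<lambda>t. \<bar>F t\<bar>)"
  unfolding sign_avg_def by (simp add: divide_right_mono)

lemma sign_avg_Suc:
  "sign_avg (Suc m) F = sign_avg m (\<lambda>t. (F t + F (insert m t)) / 2)"
proof -
  have "inj_on (insert m) (Pow {..<m})"
    by (intro inj_onI) (metis Diff_insert_absorb PowD lessThan_iff less_irrefl subsetD)
  moreover have "Pow {..<m} \<inter> insert m ` Pow {..<m} = {}"
    by auto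
  ultimately have "(\<Sum>t\<in>Pow {..<Suc m}. F t) = (\<Sum>t\<in>Pow {..<m}. F t) + (\<Sum>t\<in>Pow {..<m}. F (insert m t))"
    by (simp add: lessThan_Suc Pow_insert sum.union_disjoint sum.reindex)
  then show ?thesis
    by (simp add: sign_avg_def sum.distrib add_divide_distrib flip: sum_divide_distrib)
qed

text \<open>A function of the first \<open>m\<close> signs is unaffected by averaging over further
  ones. This makes averages of Rademacher sums constant once enough signs are included.\<close>

lemma sign_avg_stable:
  assumes F: "\<And>t. F (t \<inter> {..<m}) = F t" and "m \<le> n"
  shows "sign_avg n F = sign_avg m F"
  using assms(2)
proof (induction n rule: dec_induct)
  case (step n)
  have "F (insert n t) = F t" for t
    using F[of "insert n t"] F[of t] step.hyps by simp
  then show ?case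
    using step.IH by (simp add: sign_avg_Suc)
qed simp

definition rademacher_sum :: "(nat \<Rightarrow> real) \<Rightarrow> nat \<Rightarrow> nat set \<Rightarrow> real" where
  "rademacher_sum a m t = (\<Sum>k<m. a k * rademacher k t)"

lemma rademacher_sum_Suc:
  assumes "t \<subseteq> {..<m}"
  shows "rademacher_sum a (Suc m) t = rademacher_sum a m t - a m"
    and "rademacher_sum a (Suc m) (insert m t) = rademacher_sum a m t + a m"
proof -
  have "m \<notin> t" using assms by auto
  then show "rademacher_sum a (Suc m) t = rademacher_sum a m t - a m"
    by (simp add: rademacher_sum_def rademacher_def)
  have "(\<Sum>k<m. a k * rademacher k (insert m t)) = (\<Sum>k<m. a k * rademacher k t)"
    by (intro sum.cong) (auto simp: rademacher_def)
  then show "rademacher_sum a (Suc m) (insert m t) = rademacher_sum a m t + a m"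
    by (simp add: rademacher_sum_def rademacher_def)
qed

lemma rademacher_sum_Int: "rademacher_sum a m (t \<inter> {..<m}) = rademacher_sum a m t"
  unfolding rademacher_sum_def by (intro sum.cong) (auto simp: rademacher_def)

lemma rademacher_second_moment:
  "sign_avg m (\<lambda>t. (rademacher_sum a m t)\<^sup>2) = (\<Sum>k<m. (a k)\<^sup>2)"
proof (induction m)
  case 0
  show ?case by (simp add: sign_avg_def rademacher_sum_def)
next
  case (Suc m)
  have "sign_avg (Suc m) (\<lambda>t. (rademacher_sum a (Suc m) t)\<^sup>2) =
      sign_avg m (\<lambda>t. (rademacher_sum a m t)\<^sup>2 + (a m)\<^sup>2)"
    unfolding sign_avg_Suc
    by (rule sign_avg_cong) (simp add: rademacher_sum_Suc power2_eq_square field_simps)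
  then show ?case
    using Suc by (simp add: sign_avg_add sign_avg_const)
qed

text \<open>Averaging over the last sign removes the odd powers of \<open>a m\<close> and leaves
  \<open>s ^ 4 + 6 * a\<^sup>2 * s\<^sup>2 + a ^ 4\<close>; the second moment evaluates the middle
  term, and completing the square gives the constant 3.\<close>

lemma rademacher_fourth_moment:
  "sign_avg m (\<lambda>t. (rademacher_sum a m t) ^ 4) \<le> 3 * (\<Sum>k<m. (a k)\<^sup>2)\<^sup>2"
proof (induction m)
  case 0
  show ?case by (simp add: sign_avg_def rademacher_sum_def)
next
  case (Suc m)
  define s where "s = (\<Sum>k<m. (a k)\<^sup>2)"
  have "sign_avg (Suc m) (\<lambda>t. (rademacher_sum a (Suc m) t) ^ 4) =
      sign_avg m (\<lambda>t. (rademacher_sum a m t) ^ 4 + ((6 * (a m)\<^sup>2) * (rademacher_sum a m t)\<^sup>2 + (a m) ^ 4))"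
    unfolding sign_avg_Suc
    by (rule sign_avg_cong) (simp add: rademacher_sum_Suc power2_eq_square power4_eq_xxxx field_simps)
  also have "\<dots> \<le> 3 * s\<^sup>2 + (6 * (a m)\<^sup>2 * s + (a m) ^ 4)"
    using Suc.IH unfolding sign_avg_add sign_avg_cmult sign_avg_const rademacher_second_moment s_def by simp
  also have "\<dots> \<le> 3 * (s + (a m)\<^sup>2)\<^sup>2"
  proof -
    have "(a m) ^ 4 = ((a m)\<^sup>2)\<^sup>2" "0 \<le> ((a m)\<^sup>2)\<^sup>2" by simp_all
    then show ?thesis by (simp add: power2_sum algebra_simps)
  qed
  finally show ?case by (simp add: s_def)
qed

text \<open>In place of the Cauchy-Schwarz inequality, \<bar>s\<bar> is majorised by a quadratic
  polynomial via the arithmetic-geometric mean inequality, weighted by the standard deviation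
  \<sigma>; the second moment then evaluates the average exactly.\<close>

lemma khintchine_upper:
  "sign_avg m (\<lambda>t. \<bar>rademacher_sum a m t\<bar>) \<le> sqrt (\<Sum>k<m. (a k)\<^sup>2)"
proof (cases "(\<Sum>k<m. (a k)\<^sup>2) = 0")
  case True
  then have "\<forall>k<m. a k = 0"
    by (simp add: sum_nonneg_eq_0_iff)
  then show ?thesis
    by (simp add: rademacher_sum_def sign_avg_const)
next
  case False
  define \<sigma> where "\<sigma> = sqrt (\<Sum>k<m. (a k)\<^sup>2)"
  have \<sigma>: "\<sigma> > 0" "\<sigma>\<^sup>2 = (\<Sum>k<m. (a k)\<^sup>2)"
    using False by (simp_all add: \<sigma>_def sum_nonneg less_le)
  have "\<bar>s\<bar> \<le> (1 / (2 * \<sigma>)) * s\<^sup>2 + \<sigma> / 2" for s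
  proof -
    have "0 \<le> (\<bar>s\<bar> - \<sigma>)\<^sup>2" by simp
    then show ?thesis
      using \<sigma>(1) by (simp add: power2_diff field_simps) (simp add: power2_eq_square)
  qed
  then have "sign_avg m (\<lambda>t. \<bar>rademacher_sum a m t\<bar>) \<le>
      sign_avg m (\<lambda>t. (1 / (2 * \<sigma>)) * (rademacher_sum a m t)\<^sup>2 + \<sigma> / 2)"
    by (intro sign_avg_mono)
  also have "\<dots> = (1 / (2 * \<sigma>)) * \<sigma>\<^sup>2 + \<sigma> / 2"
    unfolding sign_avg_add sign_avg_cmult sign_avg_const rademacher_second_moment \<sigma>(2) ..
  also have "\<dots> = \<sigma>"
    using \<sigma>(1) by (simp add: power2_eq_square)
  finally show ?thesis by (simp add: \<sigma>_def)
qed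

text \<open>\<bar>s\<bar> is minorised by an even polynomial of degree 4, whose average is
  controlled by the second and fourth moments. The constant is
  \<open>1 - 3 * 4 / 27 = 5 / 9\<close>.\<close>

lemma khintchine_lower:
  "5 / 9 * sqrt (\<Sum>k<m. (a k)\<^sup>2) \<le> sign_avg m (\<lambda>t. \<bar>rademacher_sum a m t\<bar>)"
proof (cases "(\<Sum>k<m. (a k)\<^sup>2) = 0")
  case True
  then show ?thesis
    unfolding sign_avg_def by (simp add: sum_nonneg)
next
  case False
  define \<sigma> where "\<sigma> = sqrt (\<Sum>k<m. (a k)\<^sup>2)"
  have \<sigma>: "\<sigma> > 0" "\<sigma>\<^sup>2 = (\<Sum>k<m. (a k)\<^sup>2)"
    using False by (simp_all add: \<sigma>_def sum_nonneg less_le)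
  have pointwise: "(1 / \<sigma>) * s\<^sup>2 + (- 4 / (27 * \<sigma> ^ 3)) * s ^ 4 \<le> \<bar>s\<bar>" for s
  proof -
    define u where "u = \<bar>s\<bar> / \<sigma>"
    have u: "0 \<le> u" "\<bar>s\<bar> = \<sigma> * u"
      using \<sigma>(1) by (simp_all add: u_def)
    \<comment> \<open>The quartic has a double zero at \<open>u = 3 / 2\<close>, which makes 4/27
      the smallest admissible coefficient.\<close>
    have "0 \<le> 4 / 27 * u * ((u - 3 / 2)\<^sup>2 * (u + 3))"
      using u(1) by simp
    also have "\<dots> = u - u\<^sup>2 + 4 / 27 * u ^ 4"
      by (simp add: power2_eq_square power4_eq_xxxx field_simps)
    finally have "\<sigma> * (u\<^sup>2 - 4 / 27 * u ^ 4) \<le> \<sigma> * u"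
      using \<sigma>(1) by simp
    moreover have "s\<^sup>2 = (\<sigma> * u)\<^sup>2" "s ^ 4 = (\<sigma> * u) ^ 4"
      unfolding u(2)[symmetric] by simp_all
    then have "(1 / \<sigma>) * s\<^sup>2 + (- 4 / (27 * \<sigma> ^ 3)) * s ^ 4 = \<sigma> * (u\<^sup>2 - 4 / 27 * u ^ 4)"
      using \<sigma>(1) by (simp only:) (simp add: power2_eq_square power3_eq_cube power4_eq_xxxx field_simps)
    ultimately show ?thesis
      unfolding u(2) by simp
  qed
  have "5 / 9 * \<sigma> = (1 / \<sigma>) * \<sigma>\<^sup>2 + (- 4 / (27 * \<sigma> ^ 3)) * (3 * (\<sigma>\<^sup>2)\<^sup>2)"
    using \<sigma>(1) by (simp add: power2_eq_square power3_eq_cube field_simps)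
  also have "\<dots> \<le> (1 / \<sigma>) * \<sigma>\<^sup>2 + (- 4 / (27 * \<sigma> ^ 3)) * sign_avg m (\<lambda>t. (rademacher_sum a m t) ^ 4)"
    using rademacher_fourth_moment[of m a] \<sigma>
    by (intro add_left_mono mult_left_mono_neg) auto
  also have "\<dots> = sign_avg m (\<lambda>t. (1 / \<sigma>) * (rademacher_sum a m t)\<^sup>2 +
      (- 4 / (27 * \<sigma> ^ 3)) * (rademacher_sum a m t) ^ 4)"
    unfolding sign_avg_add sign_avg_cmult rademacher_second_moment \<sigma>(2) ..
  also have "\<dots> \<le> sign_avg m (\<lambda>t. \<bar>rademacher_sum a m t\<bar>)"
    by (intro sign_avg_mono pointwise)
  finally show ?thesis by (simp add: \<sigma>_def)
qed

text \<open>The index \<open>n\<close> codes a length \<open>m\<close> together with a finite set of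
  codes of subsets of \<open>{..<m}\<close>, namely those where the sign is positive. Thus a single
  sequence runs through all sign-valued functions of finitely many signs.\<close>

definition sign_pattern :: "nat \<Rightarrow> nat set \<Rightarrow> real" where
  "sign_pattern n t =
    (if set_encode (t \<inter> {..<fst (prod_decode n)}) \<in> set_decode (snd (prod_decode n)) then 1 else - 1)"

lemma abs_sign_pattern: "\<bar>sign_pattern n t\<bar> = 1"
  by (simp add: sign_pattern_def)

lemma sign_pattern_exhaustive:
  "\<exists>n. (\<forall>t. sign_pattern n (t \<inter> {..<m}) = sign_pattern n t) \<and>
    (\<forall>t\<subseteq>{..<m}. sign_pattern n t = (if P t then 1 else - 1))"
proof -
  define Q where "Q = set_encode ` {t\<in>Pow {..<m}. P t}"
  define n where "n = prod_encode (m, set_encode Q)"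
  have "finite Q" by (simp add: Q_def)
  then have n: "sign_pattern n t = (if set_encode (t \<inter> {..<m}) \<in> Q then 1 else - 1)" for t
    by (simp add: sign_pattern_def n_def set_encode_inverse)
  \<comment> \<open>\<open>set_encode\<close> can be decoded on finite sets only; subsets of
    \<open>{..<m}\<close> are finite, so distinct patterns keep distinct codes.\<close>
  have "set_encode t \<in> Q \<longleftrightarrow> P t" if "t \<subseteq> {..<m}" for t
  proof -
    have fin: "finite t'" if "t' \<subseteq> {..<m}" for t'
      using that finite_subset by blast
    show ?thesis
      using that fin set_encode_inverse unfolding Q_def image_iff by (metis (mono_tags, lifting) Pow_iff mem_Collect_eq)
  qed
  then show ?thesis
    by (intro exI[of _ n]) (simp add: n Int_absorb2)
qed

section \<open>Copies of \<open>\<ell>\<^sub>2\<close> in duals of spaces containing \<open>\<ell>\<^sub>1\<close>\<close>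

text \<open>The ordinary limit is a functional of norm at most 1 on the convergent sequences and
  extends by \<open>hahn_banach_norm\<close>. As the naturals are discrete, the type of bounded
  continuous functions on them serves as the space of bounded sequences.\<close>

lemma banach_limit:
  "\<exists>L :: (nat \<Rightarrow> real) \<Rightarrow> real.
    (\<forall>u v. bounded (range u) \<longrightarrow> bounded (range v) \<longrightarrow> L (\<lambda>n. u n + v n) = L u + L v) \<and>
    (\<forall>u r. bounded (range u) \<longrightarrow> L (\<lambda>n. r * u n) = r * L u) \<and>
    (\<forall>u B. (\<forall>n. \<bar>u n\<bar> \<le> B) \<longrightarrow> \<bar>L u\<bar> \<le> B) \<and>
    (\<forall>u l. u \<longlonglongrightarrow> l \<longrightarrow> L u = l)"
proof -
  define M where "M = {F :: nat \<Rightarrow>\<^sub>C real. convergent (apply_bcontfun F)}"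
  define \<phi> where "\<phi> F = lim (apply_bcontfun F)" for F :: "nat \<Rightarrow>\<^sub>C real"
  have M_lim: "apply_bcontfun F \<longlonglongrightarrow> \<phi> F" if "F \<in> M" for F
    using that by (simp add: M_def \<phi>_def convergent_LIMSEQ_iff)
  have plus: "apply_bcontfun (F + G) = (\<lambda>n. apply_bcontfun F n + apply_bcontfun G n)"
    and scaleR: "apply_bcontfun (c *\<^sub>R F) = (\<lambda>n. c * apply_bcontfun F n)"
    for F G :: "nat \<Rightarrow>\<^sub>C real" and c
    by (simp_all add: plus_bcontfun.rep_eq scaleR_bcontfun.rep_eq)
  have M: "subspace M"
    unfolding subspace_def
  proof (intro conjI ballI allI)
    show "0 \<in> M"
      by (simp add: M_def convergent_const)
    show "F + G \<in> M" if "F \<in> M" "G \<in> M" for F G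
      using that convergent_add by (simp add: M_def plus)
    show "c *\<^sub>R F \<in> M" if "F \<in> M" for c F
      using convergentI[OF tendsto_mult_left[OF M_lim[OF that]]] by (simp add: M_def scaleR)
  qed
  have add: "\<phi> (F + G) = \<phi> F + \<phi> G" if "F \<in> M" "G \<in> M" for F G
    unfolding \<phi>_def[of "F + G"] plus by (intro limI tendsto_add M_lim that)
  have scale: "\<phi> (c *\<^sub>R F) = c * \<phi> F" if "F \<in> M" for c F
    unfolding \<phi>_def[of "c *\<^sub>R F"] scaleR by (intro limI tendsto_mult_left M_lim that)
  have le: "\<bar>\<phi> F\<bar> \<le> 1 * norm F" if "F \<in> M" for F
    using tendsto_rabs[OF M_lim[OF that]] norm_bounded[of F]
    by (intro LIMSEQ_le_const2[where X = "\<lambda>n. \<bar>apply_bcontfun F n\<bar>"]) auto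
  obtain L :: "(nat \<Rightarrow>\<^sub>C real) \<Rightarrow>\<^sub>L real"
    where L: "\<And>F. F \<in> M \<Longrightarrow> L F = \<phi> F" "norm L \<le> 1"
    using hahn_banach_norm[OF M add scale le zero_le_one] by blast
  have apply_B: "apply_bcontfun (Bcontfun u) = u" if "bounded (range u)" for u :: "nat \<Rightarrow> real"
    using that by (simp add: Bcontfun_inverse bcontfun_def)
  have bd: "bounded (range u)" if "\<And>n. \<bar>u n\<bar> \<le> B" for u :: "nat \<Rightarrow> real" and B
    using that by (auto simp: bounded_iff)
  show ?thesis
  proof (intro exI[of _ "\<lambda>u. L (Bcontfun u)"] conjI allI impI)
    fix u v :: "nat \<Rightarrow> real" assume u: "bounded (range u)" and v: "bounded (range v)"
    have "Bcontfun (\<lambda>n. u n + v n) = Bcontfun u + Bcontfun v"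
      by (rule bcontfun_eqI) (simp add: plus apply_B u v bounded_plus_comp)
    then show "L (Bcontfun (\<lambda>n. u n + v n)) = L (Bcontfun u) + L (Bcontfun v)"
      by (simp add: blinfun.add_right)
  next
    fix u :: "nat \<Rightarrow> real" and r assume u: "bounded (range u)"
    have "bounded (range (\<lambda>n. r * u n))"
      using bounded_scaling[OF u, of r] by (simp add: image_image)
    then have "Bcontfun (\<lambda>n. r * u n) = r *\<^sub>R Bcontfun u"
      by (intro bcontfun_eqI) (simp add: scaleR apply_B u)
    then show "L (Bcontfun (\<lambda>n. r * u n)) = r * L (Bcontfun u)"
      by (simp add: blinfun.scaleR_right)
  next
    fix u :: "nat \<Rightarrow> real" and B assume u: "\<forall>n. \<bar>u n\<bar> \<le> B"
    have "\<bar>L (Bcontfun u)\<bar> \<le> norm L * norm (Bcontfun u)"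
      using norm_blinfun[of L] by simp
    also have "\<dots> \<le> norm (Bcontfun u)"
      using L(2) by (simp add: mult_left_le_one_le)
    also have "\<dots> \<le> B"
      using u bd[of u B] by (intro norm_bound) (simp add: apply_B)
    finally show "\<bar>L (Bcontfun u)\<bar> \<le> B" .
  next
    fix u :: "nat \<Rightarrow> real" and l assume u: "u \<longlonglongrightarrow> l"
    then have "apply_bcontfun (Bcontfun u) = u"
      by (intro apply_B convergent_imp_bounded) (simp add: convergent_def)
    then show "L (Bcontfun u) = l"
      using L(1)[of "Bcontfun u"] u by (simp add: M_def \<phi>_def convergentI limI)
  qed
qed

text \<open>A sequence bounded by 1 acts on \<open>ell 1\<close> by summation against it. The lower
  estimate of the embedding turns this into a functional on \<open>M\<close> of norm at most
  \<open>1 / c\<close>, which is then extended to the whole space.\<close>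

lemma ell_1_extend_functional:
  assumes T: "ell_embedding 1 (M :: 'a::real_normed_vector set) T c C" and b: "\<And>n. \<bar>b n\<bar> \<le> 1"
  obtains U :: "'a::real_normed_vector \<Rightarrow>\<^sub>L real"
  where "norm U \<le> 1 / c" "\<And>n. U (T (\<lambda>j. if j = n then 1 else 0)) = b n"
proof -
  note M = ell_embeddingD(1)[OF T] and bij = ell_embeddingD(3)[OF T] and c = ell_embeddingD(4)[OF T]
    and add = ell_embeddingD(6)[OF T] and scale = ell_embeddingD(7)[OF T] and low = ell_embeddingD(8)[OF T]
  have ell_1: "a \<in> ell 1 \<longleftrightarrow> summable (\<lambda>n. \<bar>a n\<bar>)" for a
    by (simp add: ell_def)
  have ell_add: "(\<lambda>n. a n + b n) \<in> ell 1" if "a \<in> ell 1" "b \<in> ell 1" for a b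
    using that summable_comparison_test'[OF summable_add[of "\<lambda>n. \<bar>a n\<bar>" "\<lambda>n. \<bar>b n\<bar>"], of 0 "\<lambda>n. \<bar>a n + b n\<bar>"]
    by (simp add: ell_1 abs_triangle_ineq)
  have ell_scale: "(\<lambda>n. r * a n) \<in> ell 1" if "a \<in> ell 1" for a r
    using that unfolding ell_1 by (simp add: abs_mult summable_mult)
  \<comment> \<open>Linearity of the inverse \<open>S\<close> follows from that of \<open>T\<close>
    by injectivity on \<open>ell 1\<close>, which requires sums and multiples to stay in
    \<open>ell 1\<close>.\<close>
  define S where "S = inv_into (ell 1) T"
  have S: "S v \<in> ell 1" "T (S v) = v" if "v \<in> M" for v
    using that bij unfolding S_def bij_betw_def by (auto simp: inv_into_into f_inv_into_f)
  have ST: "S (T a) = a" if "a \<in> ell 1" for a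
    using that bij unfolding S_def bij_betw_def by (simp add: inv_into_f_f)
  have S_add: "S (u + v) = (\<lambda>n. S u n + S v n)" if "u \<in> M" "v \<in> M" for u v
    using ST[OF ell_add[OF S(1)[OF that(1)] S(1)[OF that(2)]]] add[of "S u" "S v"] S that by simp
  have S_scale: "S (r *\<^sub>R v) = (\<lambda>n. r * S v n)" if "v \<in> M" for r v
    using ST[OF ell_scale[OF S(1)[OF that], of r]] scale[of "S v" r] S that by simp
  have abs_sum: "summable (\<lambda>n. \<bar>S v n * b n\<bar>)" if "v \<in> M" for v
    using S(1)[OF that] b summable_comparison_test'[of "\<lambda>n. \<bar>S v n\<bar>" 0 "\<lambda>n. \<bar>S v n * b n\<bar>"]
    by (simp add: ell_1 abs_mult mult_left_le)
  have sum: "summable (\<lambda>n. S v n * b n)" if "v \<in> M" for v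
    by (rule summable_rabs_cancel[OF abs_sum[OF that]])
  define \<phi> where "\<phi> v = (\<Sum>n. S v n * b n)" for v
  obtain U :: "'a \<Rightarrow>\<^sub>L real" where U: "\<And>v. v \<in> M \<Longrightarrow> U v = \<phi> v" "norm U \<le> 1 / c"
  proof (rule hahn_banach_norm[of M \<phi> "1 / c"])
    show "\<phi> (u + v) = \<phi> u + \<phi> v" if "u \<in> M" "v \<in> M" for u v
      using that by (simp add: \<phi>_def S_add distrib_right suminf_add sum)
    show "\<phi> (r *\<^sub>R v) = r * \<phi> v" if "v \<in> M" for r v
      using that by (simp add: \<phi>_def S_scale suminf_mult sum mult.assoc)
    show "\<bar>\<phi> v\<bar> \<le> 1 / c * norm v" if v: "v \<in> M" for v
    proof -
      have "\<bar>\<phi> v\<bar> \<le> (\<Sum>n. \<bar>S v n * b n\<bar>)"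
        unfolding \<phi>_def by (rule summable_rabs[OF abs_sum[OF v]])
      also have "\<dots> \<le> (\<Sum>n. \<bar>S v n\<bar>)"
        using S(1)[OF v] b unfolding ell_1
        by (intro suminf_le abs_sum v) (auto simp: abs_mult mult_left_le)
      also have "\<dots> = ell_norm 1 (S v)"
        using S(1)[OF v] by (simp add: ell_norm_def ell_1 suminf_nonneg)
      also have "\<dots> \<le> 1 / c * norm v"
        using low[OF S(1)[OF v]] c S(2)[OF v] by (simp add: field_simps)
      finally show ?thesis .
    qed
  qed (use M c in auto)
  show thesis
  proof
    show "norm U \<le> 1 / c" by fact
    fix n
    have e: "(\<lambda>j. if j = n then 1 else 0) \<in> ell 1" (is "?e \<in> _")
      using ell_finite_support[of "{n}" "\<lambda>_. 1" 1] by simp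
    then have "T ?e \<in> M"
      using bij unfolding bij_betw_def by blast
    then have "U (T ?e) = (\<Sum>j. ?e j * b j)"
      by (simp only: U(1) \<phi>_def ST[OF e])
    also have "\<dots> = (\<Sum>j\<in>{n}. ?e j * b j)"
      by (rule suminf_finite) auto
    finally show "U (T ?e) = b n" by simp
  qed
qed

section \<open>Closed copies of \<open>ell 2\<close> from two-sided estimates on finite sums\<close>

lemma ell_2_diff:
  assumes "a \<in> ell 2" "b \<in> ell 2"
  shows "(\<lambda>n. a n - b n) \<in> ell 2"
proof -
  have "summable (\<lambda>n. 2 * (a n)\<^sup>2 + 2 * (b n)\<^sup>2)"
    using assms unfolding ell_2_iff by (intro summable_add summable_mult)
  moreover have "(a n - b n)\<^sup>2 \<le> 2 * (a n)\<^sup>2 + 2 * (b n)\<^sup>2" for n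
    using zero_le_power2[of "a n + b n"] by (simp add: power2_eq_square algebra_simps)
  ultimately show ?thesis
    using summable_comparison_test'[of "\<lambda>n. 2 * (a n)\<^sup>2 + 2 * (b n)\<^sup>2" 0 "\<lambda>n. (a n - b n)\<^sup>2"]
    unfolding ell_2_iff by simp
qed

lemma ell_2_scale: "a \<in> ell 2 \<Longrightarrow> (\<lambda>n. r * a n) \<in> ell 2"
  unfolding ell_2_iff by (simp add: power_mult_distrib summable_mult)

lemma ell_2_add: "a \<in> ell 2 \<Longrightarrow> b \<in> ell 2 \<Longrightarrow> (\<lambda>n. a n + b n) \<in> ell 2"
  using ell_2_diff[OF _ ell_2_scale[of b "- 1"]] by simp

lemma ell_norm_2_eq_0:
  assumes "a \<in> ell 2" "ell_norm 2 a \<le> 0"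
  shows "a = (\<lambda>_. 0)"
proof -
  have "(\<Sum>n. (a n)\<^sup>2) = 0"
    using assms suminf_nonneg[of "\<lambda>n. (a n)\<^sup>2"] by (simp add: ell_norm_2 ell_2_iff)
  then show ?thesis
    using assms(1) suminf_eq_zero_iff[of "\<lambda>n. (a n)\<^sup>2"] by (auto simp: ell_2_iff)
qed

text \<open>Both estimates pass from partial sums to the series \<open>T a\<close>. Being bounded
  below, \<open>T\<close> is injective and, by completeness of \<open>ell 2\<close> (proved here
  through coordinatewise limits), has closed range.\<close>

lemma ell_2_embedsI:
  fixes y :: "nat \<Rightarrow> 'a::banach"
  assumes c: "0 < c" and up: "upper_l2_bound C y"
    and low: "\<And>n a. c * sqrt (\<Sum>k<n. (a k)\<^sup>2) \<le> norm (\<Sum>k<n. a k *\<^sub>R y k)"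
  shows "ell_embeds 2 TYPE('a)"
proof -
  define T where "T a = (\<Sum>k. a k *\<^sub>R y k)" for a
  have sm: "summable (\<lambda>k. a k *\<^sub>R y k)" if "a \<in> ell 2" for a
    using that upper_l2_bound_summable[OF up] by (simp add: ell_2_iff)
  have add: "T (\<lambda>n. a n + b n) = T a + T b" if "a \<in> ell 2" "b \<in> ell 2" for a b
    using suminf_add[OF sm[OF that(1)] sm[OF that(2)]] by (simp add: T_def scaleR_left_distrib)
  have diff: "T (\<lambda>n. a n - b n) = T a - T b" if "a \<in> ell 2" "b \<in> ell 2" for a b
    using suminf_diff[OF sm[OF that(1)] sm[OF that(2)]] by (simp add: T_def scaleR_left_diff_distrib)
  have scale: "T (\<lambda>n. r * a n) = r *\<^sub>R T a" if "a \<in> ell 2" for a r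
    using suminf_scaleR_right[OF sm[OF that], of r] by (simp add: T_def)
  have T_up: "norm (T a) \<le> C * ell_norm 2 a" if "a \<in> ell 2" for a
    using upper_l2_bound_suminf[OF up] that by (simp add: T_def ell_norm_2 ell_2_iff)
  have T_low: "c * ell_norm 2 a \<le> norm (T a)" if a: "a \<in> ell 2" for a
    unfolding ell_norm_2[OF a] T_def
  proof (rule LIMSEQ_le)
    show "(\<lambda>n. c * sqrt (\<Sum>k<n. (a k)\<^sup>2)) \<longlonglongrightarrow> c * sqrt (\<Sum>k. (a k)\<^sup>2)"
      by (intro tendsto_intros summable_LIMSEQ a[unfolded ell_2_iff])
    show "(\<lambda>n. norm (\<Sum>k<n. a k *\<^sub>R y k)) \<longlonglongrightarrow> norm (\<Sum>k. a k *\<^sub>R y k)"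
      by (intro tendsto_norm summable_LIMSEQ sm a)
  qed (use low in blast)
  have inj: "inj_on T (ell 2)"
  proof (rule inj_onI)
    fix a b assume ab: "a \<in> ell 2" "b \<in> ell 2" "T a = T b"
    then have "c * ell_norm 2 (\<lambda>n. a n - b n) \<le> 0"
      using T_low[OF ell_2_diff[OF ab(1,2)]] diff by simp
    then have "(\<lambda>n. a n - b n) = (\<lambda>_. 0)"
      using c ab by (intro ell_norm_2_eq_0 ell_2_diff) (simp_all add: mult_le_0_iff)
    then show "a = b"
      by (simp add: fun_eq_iff)
  qed
  define M where "M = T ` ell 2"
  have zero: "(\<lambda>_. 0) \<in> ell 2"
    by (simp add: ell_2_iff)
  have "subspace M"
    unfolding subspace_def M_def
  proof (intro conjI ballI allI)
    show "0 \<in> T ` ell 2"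
      using zero by (intro image_eqI[of _ _ "\<lambda>_. 0"]) (simp_all add: T_def)
    show "u + v \<in> T ` ell 2" if "u \<in> T ` ell 2" "v \<in> T ` ell 2" for u v
      using that by (auto simp: ell_2_add simp flip: add)
    show "r *\<^sub>R u \<in> T ` ell 2" if "u \<in> T ` ell 2" for r u
      using that by (auto simp: ell_2_scale simp flip: scale)
  qed
  moreover have "closed M"
    unfolding closed_sequential_limits
  proof (intro allI impI, elim conjE)
    fix v :: "nat \<Rightarrow> 'a" and l assume v: "\<forall>i. v i \<in> M" and l: "v \<longlonglongrightarrow> l"
    then have "\<forall>i. \<exists>\<alpha>. \<alpha> \<in> ell 2 \<and> v i = T \<alpha>"
      by (auto simp: M_def)
    from choice[OF this] obtain \<alpha> where \<alpha>: "\<And>i. \<alpha> i \<in> ell 2" "\<And>i. v i = T (\<alpha> i)"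
      by blast
    have part: "c * sqrt (\<Sum>k<n. (\<alpha> i k - \<alpha> j k)\<^sup>2) \<le> norm (v i - v j)" for i j n
    proof -
      have "sqrt (\<Sum>k<n. (\<alpha> i k - \<alpha> j k)\<^sup>2) \<le> ell_norm 2 (\<lambda>k. \<alpha> i k - \<alpha> j k)"
        using ell_2_diff[OF \<alpha>(1) \<alpha>(1), of i j]
        by (simp add: ell_norm_2 ell_2_iff sum_le_suminf)
      then have "c * sqrt (\<Sum>k<n. (\<alpha> i k - \<alpha> j k)\<^sup>2) \<le> c * ell_norm 2 (\<lambda>k. \<alpha> i k - \<alpha> j k)"
        using c by simp
      also have "\<dots> \<le> norm (v i - v j)"
        using T_low[OF ell_2_diff[OF \<alpha>(1) \<alpha>(1), of i j]] \<alpha> by (simp add: diff)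
      finally show ?thesis .
    qed
    have coord: "c * \<bar>\<alpha> i k - \<alpha> j k\<bar> \<le> norm (v i - v j)" for i j k
    proof -
      have "(\<alpha> i k - \<alpha> j k)\<^sup>2 \<le> (\<Sum>k<Suc k. (\<alpha> i k - \<alpha> j k)\<^sup>2)"
        by (simp add: sum_nonneg)
      then have "\<bar>\<alpha> i k - \<alpha> j k\<bar> \<le> sqrt (\<Sum>k<Suc k. (\<alpha> i k - \<alpha> j k)\<^sup>2)"
        by (rule real_le_rsqrt[of "\<bar>_\<bar>", simplified])
      then show ?thesis
        using part[where n = "Suc k"] c by (meson less_imp_le mult_left_mono order_trans)
    qed
    have "Cauchy (\<lambda>i. \<alpha> i k)" for k
    proof (rule metric_CauchyI)
      fix e :: real assume "e > 0"
      then have "c * e > 0" using c by simp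
      moreover have "Cauchy v"
        using l LIMSEQ_imp_Cauchy by blast
      ultimately obtain N where N: "\<And>i j. i \<ge> N \<Longrightarrow> j \<ge> N \<Longrightarrow> dist (v i) (v j) < c * e"
        using metric_CauchyD by blast
      have "\<bar>\<alpha> i k - \<alpha> j k\<bar> < e" if "i \<ge> N" "j \<ge> N" for i j
      proof -
        have "c * \<bar>\<alpha> i k - \<alpha> j k\<bar> < c * e"
          using coord[of i k j] N[OF that] by (simp add: dist_norm)
        then show ?thesis using c by simp
      qed
      then show "\<exists>N. \<forall>i\<ge>N. \<forall>j\<ge>N. dist (\<alpha> i k) (\<alpha> j k) < e"
        by (auto simp: dist_real_def)
    qed
    then have "\<forall>k. \<exists>b. (\<lambda>i. \<alpha> i k) \<longlonglongrightarrow> b"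
      by (simp add: Cauchy_convergent_iff convergent_def)
    from choice[OF this] obtain \<beta> where \<beta>: "\<And>k. (\<lambda>i. \<alpha> i k) \<longlonglongrightarrow> \<beta> k"
      by blast
    \<comment> \<open>The estimate is kept on finite partial sums while \<open>i\<close> tends to
      infinity, since only coordinatewise convergence to \<beta> is known so far; \<beta> is not yet
      known to lie in \<open>ell 2\<close>.\<close>
    have part': "c * sqrt (\<Sum>k<n. (\<beta> k - \<alpha> j k)\<^sup>2) \<le> norm (l - v j)" for j n
    proof (rule LIMSEQ_le)
      show "(\<lambda>i. c * sqrt (\<Sum>k<n. (\<alpha> i k - \<alpha> j k)\<^sup>2)) \<longlonglongrightarrow> c * sqrt (\<Sum>k<n. (\<beta> k - \<alpha> j k)\<^sup>2)"
        by (intro tendsto_intros \<beta>)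
      show "(\<lambda>i. norm (v i - v j)) \<longlonglongrightarrow> norm (l - v j)"
        by (intro tendsto_intros l)
    qed (use part in blast)
    have sq: "(\<Sum>k<n. (\<beta> k - \<alpha> j k)\<^sup>2) \<le> (norm (l - v j) / c)\<^sup>2" for j n
      using part'[of j n] c by (intro sqrt_le_D) (simp add: field_simps)
    have \<beta>\<alpha>: "(\<lambda>k. \<beta> k - \<alpha> j k) \<in> ell 2" for j
      unfolding ell_2_iff
      by (rule summableI_nonneg_bounded[where x = "(norm (l - v j) / c)\<^sup>2"]) (use sq in auto)
    then have \<beta>2: "\<beta> \<in> ell 2"
      using ell_2_add[OF \<beta>\<alpha> \<alpha>(1), of 0 0] by simp
    have "norm (T \<beta> - v j) \<le> C * (norm (l - v j) / c)" for j
    proof -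
      have "ell_norm 2 (\<lambda>k. \<beta> k - \<alpha> j k) \<le> norm (l - v j) / c"
        unfolding ell_norm_2[OF \<beta>\<alpha>] using sq c \<beta>\<alpha>[of j, unfolded ell_2_iff]
        by (intro real_le_lsqrt suminf_le_const suminf_nonneg) auto
      moreover have "0 \<le> C" using up by (simp add: upper_l2_bound_def)
      ultimately show ?thesis
        using T_up[OF \<beta>\<alpha>, of j] diff[OF \<beta>2 \<alpha>(1), of j] \<alpha>(2)[of j]
        by (smt (verit) mult_left_mono)
    qed
    moreover have "(\<lambda>j. C * (norm (l - v j) / c)) \<longlonglongrightarrow> C * (norm (l - l) / c)"
      by (intro tendsto_intros l) (use c in simp)
    ultimately have "(\<lambda>j. T \<beta> - v j) \<longlonglongrightarrow> 0"
      using Lim_null_comparison[of "\<lambda>j. T \<beta> - v j" "\<lambda>j. C * (norm (l - v j) / c)"] by simp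
    from tendsto_diff[OF tendsto_const[of "T \<beta>"] this] have "v \<longlonglongrightarrow> T \<beta>"
      by simp
    then have "l = T \<beta>"
      using l LIMSEQ_unique by blast
    then show "l \<in> M"
      using \<beta>2 by (simp add: M_def)
  qed
  \<comment> \<open>An embedding requires a positive upper constant, while
    \<open>upper_l2_bound\<close> only provides \<open>0 \<le> C\<close>.\<close>
  moreover have "C + 1 > 0"
    using up by (simp add: upper_l2_bound_def add_nonneg_pos)
  moreover have "norm (T a) \<le> (C + 1) * ell_norm 2 a" if "a \<in> ell 2" for a
    using T_up[OF that] suminf_nonneg[of "\<lambda>n. (a n)\<^sup>2"] that
    by (simp add: distrib_right ell_norm_2 ell_2_iff add_increasing2)
  ultimately have "ell_embedding 2 M T c (C + 1)"
    using inj c add scale T_low unfolding ell_embedding_def bij_betw_def M_def by simp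
  then show ?thesis
    unfolding ell_embeds_iff by blast
qed

text \<open>Padding the coefficients with zeros turns a finite index set into an initial
  segment.\<close>

lemma upper_l2_boundI:
  assumes C: "0 \<le> C" and bd: "\<And>n a. norm (\<Sum>k<n. a k *\<^sub>R y k) \<le> C * sqrt (\<Sum>k<n. (a k)\<^sup>2)"
  shows "upper_l2_bound C y"
  unfolding upper_l2_bound_def
proof (intro conjI allI impI)
  fix F :: "nat set" and a :: "nat \<Rightarrow> real" assume "finite F"
  then obtain n where n: "F \<subseteq> {..<n}"
    using finite_nat_iff_bounded by blast
  define b where "b k = (if k \<in> F then a k else 0)" for k
  have "(\<Sum>k<n. b k *\<^sub>R y k) = (\<Sum>k\<in>F. a k *\<^sub>R y k)" "(\<Sum>k<n. (b k)\<^sup>2) = (\<Sum>k\<in>F. (a k)\<^sup>2)"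
    using n by (auto simp: b_def intro!: sum.mono_neutral_cong_right)
  then show "norm (\<Sum>k\<in>F. a k *\<^sub>R y k) \<le> C * sqrt (\<Sum>k\<in>F. (a k)\<^sup>2)"
    using bd[where n = n and a = b] by simp
qed (fact C)

text \<open>The operator \<open>e\<^sub>n \<mapsto> sign_pattern n\<close> from \<open>ell 1\<close> into the bounded functions of \<open>t\<close> is extended
  coordinatewise to the functionals \<open>U t\<close> on the whole space. A Banach limit of averages replaces
  integration over the Cantor group, since \<open>U t z\<close> need not be measurable in \<open>t\<close>.\<close>

lemma ell_1_embeds_imp_l2_functionals:
  assumes "ell_embeds 1 TYPE('z::real_normed_vector)"
  shows "\<exists>(f :: nat \<Rightarrow> 'z \<Rightarrow>\<^sub>L real) d D. 0 < d \<and> 0 \<le> D \<and>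
    (\<forall>n a. d * sqrt (\<Sum>k<n. (a k)\<^sup>2) \<le> norm (\<Sum>k<n. a k *\<^sub>R f k)) \<and>
    (\<forall>n a. norm (\<Sum>k<n. a k *\<^sub>R f k) \<le> D * sqrt (\<Sum>k<n. (a k)\<^sup>2))"
proof -
  obtain M :: "'z set" and T c C where T: "ell_embedding 1 M T c C"
    using assms unfolding ell_embeds_iff by (elim exE)
  note c = ell_embeddingD(4)[OF T] and C = ell_embeddingD(5)[OF T]
  define x where "x n = T (\<lambda>j. if j = n then 1 else 0)" for n
  have norm_x: "norm (x n) \<le> C" for n
    using ell_embeddingD(9)[OF T, of "\<lambda>j. if j = n then 1 else 0"]
      ell_finite_support[of "{n}" "\<lambda>_. 1" 1] ell_norm_finite_support[of "{n}" 1 "\<lambda>_. 1"]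
    by (simp add: x_def)
  have "\<exists>U :: 'z \<Rightarrow>\<^sub>L real. norm U \<le> 1 / c \<and> (\<forall>n. blinfun_apply U (x n) = sign_pattern n t)" for t
    by (rule ell_1_extend_functional[OF T, of "\<lambda>n. sign_pattern n t"])
      (auto simp: abs_sign_pattern x_def)
  then have "\<forall>t. \<exists>U :: 'z \<Rightarrow>\<^sub>L real. norm U \<le> 1 / c \<and> (\<forall>n. blinfun_apply U (x n) = sign_pattern n t)"
    by simp
  from choice[OF this] obtain U :: "nat set \<Rightarrow> 'z \<Rightarrow>\<^sub>L real"
    where norm_U: "\<And>t. norm (U t) \<le> 1 / c" and Ux: "\<And>t n. U t (x n) = sign_pattern n t"
    by blast
  have U_le: "\<bar>U t z\<bar> \<le> norm z / c" for t z
  proof -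
    have "\<bar>U t z\<bar> \<le> norm (U t) * norm z"
      using norm_blinfun[of "U t" z] by simp
    also have "\<dots> \<le> 1 / c * norm z"
      by (intro mult_right_mono norm_U) simp
    finally show ?thesis by simp
  qed
  obtain L :: "(nat \<Rightarrow> real) \<Rightarrow> real" where
    *: "(\<forall>u v. bounded (range u) \<longrightarrow> bounded (range v) \<longrightarrow> L (\<lambda>n. u n + v n) = L u + L v) \<and>
      (\<forall>u r. bounded (range u) \<longrightarrow> L (\<lambda>n. r * u n) = r * L u) \<and>
      (\<forall>u B. (\<forall>n. \<bar>u n\<bar> \<le> B) \<longrightarrow> \<bar>L u\<bar> \<le> B) \<and> (\<forall>u l. u \<longlonglongrightarrow> l \<longrightarrow> L u = l)"
    using banach_limit by (elim exE)
  then have L_add: "\<And>u v. bounded (range u) \<Longrightarrow> bounded (range v) \<Longrightarrow> L (\<lambda>n. u n + v n) = L u + L v"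
    and L_mult: "\<And>u r. bounded (range u) \<Longrightarrow> L (\<lambda>n. r * u n) = r * L u"
    and L_le: "\<And>u B. \<forall>n. \<bar>u n\<bar> \<le> B \<Longrightarrow> \<bar>L u\<bar> \<le> B"
    and L_lim: "\<And>u l. u \<longlonglongrightarrow> l \<Longrightarrow> L u = l"
    by simp_all
  \<comment> \<open>\<open>L\<close> ignores finitely many terms: replacing them by 0 changes the
    sequence by one that tends to 0.\<close>
  have L_tail: "\<bar>L u\<bar> \<le> B" if u: "bounded (range u)" and B: "0 \<le> B" "\<And>n. n \<ge> N \<Longrightarrow> \<bar>u n\<bar> \<le> B" for u B N
  proof -
    define v where "v n = (if n < N then 0 else u n)" for n
    have v: "\<bar>v n\<bar> \<le> B" for n
      using B by (simp add: v_def)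
    have bv: "bounded (range v)"
      using v by (auto simp: bounded_iff)
    have "(\<lambda>n. u n - v n) \<longlonglongrightarrow> 0"
      by (rule tendsto_eventually) (auto simp: v_def eventually_sequentially intro!: exI[of _ N])
    then have "L (\<lambda>n. u n - v n) = 0"
      by (rule L_lim)
    moreover have "L (\<lambda>n. v n + (u n - v n)) = L v + L (\<lambda>n. u n - v n)"
      by (intro L_add bv bounded_minus_comp u)
    ultimately have "L u = L v" by simp
    then show ?thesis
      using L_le[of v B] v by simp
  qed
  \<comment> \<open>For fixed \<open>z\<close>, the averages over the first \<open>m\<close> signs
    form a bounded sequence in \<open>m\<close>; \<open>L\<close> of it replaces the integral of
    \<open>rademacher k t * U t z\<close> over all \<open>t\<close>.\<close>
  define w where "w k z m = sign_avg m (\<lambda>t. rademacher k t * U t z)" for k z m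
  have w_le: "\<bar>w k z m\<bar> \<le> norm z / c" for k z m
  proof -
    have "\<bar>w k z m\<bar> \<le> sign_avg m (\<lambda>t. \<bar>rademacher k t * U t z\<bar>)"
      unfolding w_def by (rule abs_sign_avg_le)
    also have "\<dots> \<le> sign_avg m (\<lambda>t. norm z / c)"
      using U_le by (intro sign_avg_mono) (simp add: rademacher_def)
    finally show ?thesis by (simp add: sign_avg_const)
  qed
  have bw: "bounded (range (w k z))" for k z
    using w_le[of k z] by (auto simp: bounded_iff)
  have bl: "bounded_linear (\<lambda>z. L (w k z))" for k
  proof (rule bounded_linear_intro[of _ "1 / c"])
    fix z z' :: 'z and r :: real
    have "w k (z + z') = (\<lambda>m. w k z m + w k z' m)"
      by (simp add: fun_eq_iff w_def blinfun.add_right distrib_left sign_avg_add)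
    then show "L (w k (z + z')) = L (w k z) + L (w k z')"
      by (simp add: L_add bw)
    have "w k (r *\<^sub>R z) = (\<lambda>m. r * w k z m)"
      by (simp add: fun_eq_iff w_def blinfun.scaleR_right sign_avg_cmult[symmetric] ac_simps)
    then show "L (w k (r *\<^sub>R z)) = r *\<^sub>R L (w k z)"
      by (simp add: L_mult bw)
    show "norm (L (w k z)) \<le> norm z * (1 / c)"
      using L_le[of "w k z" "norm z / c"] w_le by simp
  qed
  define f where "f k = Blinfun (\<lambda>z. L (w k z))" for k
  have f: "f k z = L (w k z)" for k z
    by (simp add: f_def bounded_linear_Blinfun_apply[OF bl])
  \<comment> \<open>The whole combination is averaged before \<open>L\<close> is applied; estimating
    the \<open>f k\<close> one by one would lose the cancellation that Khintchine's inequality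
    measures.\<close>
  define W where "W a n z m = sign_avg m (\<lambda>t. rademacher_sum a n t * U t z)" for a n z m
  have W_Suc: "W a (Suc n) z = (\<lambda>m. W a n z m + a n * w n z m)" for a n z
    by (simp add: fun_eq_iff W_def w_def rademacher_sum_def distrib_right sign_avg_add
        mult.assoc sign_avg_cmult)
  have W_0: "W a 0 z = (\<lambda>m. 0)" for a z
    by (simp add: fun_eq_iff W_def rademacher_sum_def sign_avg_const)
  have W: "bounded (range (W a n z)) \<and> (\<Sum>k<n. a k *\<^sub>R f k) z = L (W a n z)" for a n z
  proof (induction n)
    case 0
    show ?case
      using L_lim[OF tendsto_const[of 0]] by (simp add: W_0)
  next
    case (Suc n)
    have "bounded (range (\<lambda>m. a n * w n z m))"
      using bounded_scaling[OF bw, of "a n"] by (simp add: image_image)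
    then show ?case
      using Suc by (simp add: W_Suc L_add L_mult bw f blinfun.add_left blinfun.scaleR_left bounded_plus_comp)
  qed
  have up: "norm (\<Sum>k<n. a k *\<^sub>R f k) \<le> 1 / c * sqrt (\<Sum>k<n. (a k)\<^sup>2)" for n a
  proof (rule norm_blinfun_bound)
    fix z
    \<comment> \<open>Only for \<open>m \<ge> n\<close> are all signs in the Rademacher sum averaged
      over; the earlier terms are discarded by \<open>L_tail\<close>.\<close>
    have "\<bar>W a n z m\<bar> \<le> norm z / c * sqrt (\<Sum>k<n. (a k)\<^sup>2)" if m: "m \<ge> n" for m
    proof -
      have "\<bar>W a n z m\<bar> \<le> sign_avg m (\<lambda>t. \<bar>rademacher_sum a n t * U t z\<bar>)"
        unfolding W_def by (rule abs_sign_avg_le)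
      also have "\<dots> \<le> sign_avg m (\<lambda>t. norm z / c * \<bar>rademacher_sum a n t\<bar>)"
      proof (rule sign_avg_mono)
        fix t
        have "\<bar>rademacher_sum a n t\<bar> * \<bar>U t z\<bar> \<le> \<bar>rademacher_sum a n t\<bar> * (norm z / c)"
          by (intro mult_left_mono U_le) simp
        then show "\<bar>rademacher_sum a n t * U t z\<bar> \<le> norm z / c * \<bar>rademacher_sum a n t\<bar>"
          by (simp add: abs_mult ac_simps)
      qed
      also have "\<dots> = norm z / c * sign_avg n (\<lambda>t. \<bar>rademacher_sum a n t\<bar>)"
        unfolding sign_avg_cmult using sign_avg_stable[of "\<lambda>t. \<bar>rademacher_sum a n t\<bar>" n m] m
        by (simp add: rademacher_sum_Int)
      also have "\<dots> \<le> norm z / c * sqrt (\<Sum>k<n. (a k)\<^sup>2)"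
        using c by (intro mult_left_mono khintchine_upper) simp
      finally show ?thesis .
    qed
    then have "\<bar>L (W a n z)\<bar> \<le> norm z / c * sqrt (\<Sum>k<n. (a k)\<^sup>2)"
      using W[of a n z] c by (intro L_tail[where N = n]) (simp_all add: sum_nonneg)
    then show "norm ((\<Sum>k<n. a k *\<^sub>R f k) z) \<le> 1 / c * sqrt (\<Sum>k<n. (a k)\<^sup>2) * norm z"
      using W[of a n z] by (simp add: ac_simps)
  qed (use c in \<open>simp add: sum_nonneg\<close>)
  have low: "5 / (9 * C) * sqrt (\<Sum>k<n. (a k)\<^sup>2) \<le> norm (\<Sum>k<n. a k *\<^sub>R f k)" for n a
  proof -
    \<comment> \<open>The unit vector whose pattern is the sign of the Rademacher sum: testing at
      \<open>x j\<close> turns the sum into its absolute value.\<close>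
    obtain j where j: "\<And>t. sign_pattern j (t \<inter> {..<n}) = sign_pattern j t"
      "\<And>t. t \<subseteq> {..<n} \<Longrightarrow> sign_pattern j t = (if 0 \<le> rademacher_sum a n t then 1 else - 1)"
      using sign_pattern_exhaustive[of n "\<lambda>t. 0 \<le> rademacher_sum a n t"] by blast
    have "W a n (x j) m = sign_avg n (\<lambda>t. \<bar>rademacher_sum a n t\<bar>)" if "m \<ge> n" for m
    proof -
      have "W a n (x j) m = sign_avg n (\<lambda>t. rademacher_sum a n t * sign_pattern j t)"
        unfolding W_def Ux using that by (intro sign_avg_stable) (simp_all add: rademacher_sum_Int j)
      also have "\<dots> = sign_avg n (\<lambda>t. \<bar>rademacher_sum a n t\<bar>)"
        by (rule sign_avg_cong) (simp add: j)
      finally show ?thesis .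
    qed
    then have "W a n (x j) \<longlonglongrightarrow> sign_avg n (\<lambda>t. \<bar>rademacher_sum a n t\<bar>)"
      by (intro tendsto_eventually) (auto simp: eventually_sequentially)
    then have "(\<Sum>k<n. a k *\<^sub>R f k) (x j) = sign_avg n (\<lambda>t. \<bar>rademacher_sum a n t\<bar>)"
      using W L_lim by simp
    then have "5 / 9 * sqrt (\<Sum>k<n. (a k)\<^sup>2) \<le> (\<Sum>k<n. a k *\<^sub>R f k) (x j)"
      using khintchine_lower[of a n] by simp
    also have "\<dots> \<le> norm (\<Sum>k<n. a k *\<^sub>R f k) * norm (x j)"
      using norm_blinfun[of "\<Sum>k<n. a k *\<^sub>R f k" "x j"] by simp
    also have "\<dots> \<le> norm (\<Sum>k<n. a k *\<^sub>R f k) * C"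
      by (intro mult_left_mono norm_x) simp
    finally show ?thesis
      using C by (simp add: field_simps)
  qed
  show ?thesis
    \<comment> \<open>The lower constant combines 5/9 from Khintchine's inequality with the bound
      \<open>C\<close> on the norms of the \<open>x j\<close>; the upper one is the bound on the
      norms of the \<open>U t\<close>.\<close>
    by (intro exI[of _ f] exI[of _ "5 / (9 * C)"] exI[of _ "1 / c"] conjI allI low up) (use c C in auto)
qed

text \<open>The isometry \<open>J\<close> carries both estimates from the functionals to their
  preimages in \<open>'y\<close>, and completeness of \<open>'y\<close> then yields the closed
  copy.\<close>

lemma ell_1_embeds_imp_ell_2_embeds_dual:
  assumes "is_dual_of TYPE('y::banach) TYPE('z::real_normed_vector)" and "ell_embeds 1 TYPE('z)"
  shows "ell_embeds 2 TYPE('y)"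
proof -
  obtain J :: "'y \<Rightarrow> ('z \<Rightarrow>\<^sub>L real)" where J: "linear J" "bij J" "\<And>y. norm (J y) = norm y"
    using assms(1) unfolding is_dual_of_def by blast
  obtain f :: "nat \<Rightarrow> 'z \<Rightarrow>\<^sub>L real" and d D where f: "0 < d" "0 \<le> D"
    "\<forall>n a. d * sqrt (\<Sum>k<n. (a k)\<^sup>2) \<le> norm (\<Sum>k<n. a k *\<^sub>R f k)"
    "\<forall>n a. norm (\<Sum>k<n. a k *\<^sub>R f k) \<le> D * sqrt (\<Sum>k<n. (a k)\<^sup>2)"
    using ell_1_embeds_imp_l2_functionals[OF assms(2)] by (elim exE conjE)
  define y where "y k = inv J (f k)" for k
  have "J (y k) = f k" for k
    using J(2) by (simp add: y_def bij_is_surj surj_f_inv_f)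
  then have norm_eq: "norm (\<Sum>k<n. a k *\<^sub>R y k) = norm (\<Sum>k<n. a k *\<^sub>R f k)" for n a
    by (simp add: linear_sum[OF J(1)] linear_scale[OF J(1)] flip: J(3))
  show ?thesis
    by (rule ell_2_embedsI[of d D y, OF f(1) upper_l2_boundI[OF f(2)]]) (simp_all add: norm_eq f(3,4))
qed

text \<open>The spaces are assumed nonzero because otherwise the operator space is trivial and has
  both properties, whatever the other space is. The assumption supplies the unit vectors for the two
  isometric embeddings.\<close>

theorem theorem11:
  fixes p :: real
  assumes p: "1 \<le> p"
    and X_nonzero: "(UNIV :: 'x::banach set) \<noteq> {0}"
    and Y_nonzero: "(UNIV :: 'y::banach set) \<noteq> {0}"
  shows "(gelfand_phillips TYPE(('x, 'y) wstar_op) \<longrightarrow>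
            gelfand_phillips TYPE('x) \<and> gelfand_phillips TYPE('y) \<and>
            (\<not> ell_embeds 2 TYPE('x) \<or> \<not> ell_embeds 2 TYPE('y)) \<and>
            (is_dual_of TYPE('y) TYPE('z::banach) \<longrightarrow>
              \<not> ell_embeds 2 TYPE('y) \<longrightarrow> \<not> ell_embeds 1 TYPE('z)))
       \<and> (p_gelfand_phillips p TYPE(('x, 'y) wstar_op) \<longrightarrow>
            p_gelfand_phillips p TYPE('x) \<and> p_gelfand_phillips p TYPE('y) \<and>
            (\<not> ell_embeds 2 TYPE('x) \<or> \<not> ell_embeds 2 TYPE('y)) \<and>
            (is_dual_of TYPE('y) TYPE('z) \<longrightarrow>
              \<not> ell_embeds 2 TYPE('y) \<longrightarrow> \<not> ell_embeds 1 TYPE('z)))"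
proof -
  obtain x0 :: 'x where x0: "norm x0 = 1"
    by (rule exists_norm_one[OF X_nonzero])
  obtain y0 :: 'y where y0: "norm y0 = 1"
    by (rule exists_norm_one[OF Y_nonzero])
  note X_isometry = bounded_linear_rank_one_left[of y0]
  note Y_isometry = bounded_linear_rank_one_right[of x0]
  have iso: "norm (rank_one x y0) = norm x" "norm (rank_one x0 y) = norm y" for x :: 'x and y :: 'y
    by (simp_all add: norm_rank_one x0 y0)
  have dual: "is_dual_of TYPE('y) TYPE('z) \<longrightarrow> \<not> ell_embeds 2 TYPE('y) \<longrightarrow> \<not> ell_embeds 1 TYPE('z)"
    using ell_1_embeds_imp_ell_2_embeds_dual by blast
  have no_ell_2: "\<not> ell_embeds 2 TYPE('x) \<or> \<not> ell_embeds 2 TYPE('y)"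
    if "p_gelfand_phillips p TYPE(('x, 'y) wstar_op)"
    using not_both_ell_2_embed[OF that p] .
  \<comment> \<open>This reduces the alternative about \<open>ell 2\<close> in the GP case to the
    \<open>p\<close>-GP case.\<close>
  have GP_imp: "p_gelfand_phillips p TYPE(('x, 'y) wstar_op)" if "gelfand_phillips TYPE(('x, 'y) wstar_op)"
    using gelfand_phillips_imp_p_gelfand_phillips[OF that] p by simp
  show ?thesis
    using gelfand_phillips_isometry[OF X_isometry iso(1)] gelfand_phillips_isometry[OF Y_isometry iso(2)]
      p_gelfand_phillips_isometry[OF X_isometry iso(1), where p = p]
      p_gelfand_phillips_isometry[OF Y_isometry iso(2), where p = p]
      no_ell_2 GP_imp dual
    by blast
qed

end
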